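(* Let a group $G$ act faithfully on each of $n$ disjoint sets $S_1,S_2,\dots,S_n$, and suppose for each $2\le j\le n$ we have a $G$-equivariant bijection $f_j\colon S_1\to S_j$. Let $f_1\colon S_1\to S_1$ be the identity function. Let $\overline{S}:=S_1\sqcup\cdots\sqcup S_n$ and define the "meta-rotation" $\overline{f}\colon\overline{S}\to\overline{S}$ by $$\overline{f}:=\bigsqcup_{j=1}^{n}\left(f_{j+1}\circ f_j^{-1}\right)\colon\ \bigsqcup_{j=1}^nS_j\longrightarrow\bigsqcup_{j=1}^nS_{j+1},$$ with indices read modulo $n$; that is, $\overline{f}$ restricted to $S_j$ is $f_{j+1}\circ f_j^{-1}\colon S_j\to S_{j+1}$ for $j<n$, and on $S_n$ it is $f_1\circ f_n^{-1}\colon S_n\to S_1$. Let every $g\in G$ act on $\overline{S}$ as the union of its actions on $S_1,\dots,S_n$; this action is faithful, and $G$ is regarded as a subgroup of $\mathrm{Sym}(\overline{S})$ via it. Let $\overline{G}:=\langle G,\overline{f}\rangle\le\mathrm{Sym}(\overline{S})$. Then: (1) $\overline{f}$ is $G$-equivariant and has order $n$. (2) $G$ and $\langle\overline{f}\rangle$ commute in $\mathrm{Sym}(\overline{S})$, and $\overline{G}$ is an internal direct product of $G$ and $\langle\overline{f}\rangle$. Moreover, $\overline{G}$ is the disjoint union $$\overline{G}=G\cup\overline{f}G\cup\cdots\cup\overline{f}^{n-1}G=G\cup G\overline{f}\cup\cdots\cup G\overline{f}^{n-1},$$ where $G$ is exactly the set of those transformations in $\overline{G}$ that preserve each $S_j$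 for $1\le j\le n$, and the coset $\overline{f}^iG=G\overline{f}^i$ is exactly the set of those transformations in $\overline{G}$ that send $S_j$ to $S_{j+i}$ for all $1\le j\le n$ (indices read modulo $n$). (3) There is a short exact sequence $$\{Id_{\overline{S}}\}\longrightarrow G\longrightarrow\overline{G}\longrightarrow\langle\overline{f}\rangle\longrightarrow\{Id_{\overline{S}}\},$$ where $G\to\overline{G}$ is the inclusion and $\overline{G}\to\langle\overline{f}\rangle$ is $g\overline{f}^i\mapsto\overline{f}^i$. This short exact sequence is left split, so is isomorphic to the direct product short exact sequence of $G$ and $\langle\overline{f}\rangle$. (4) If the action of $G$ on any one $S_{j_0}$ is simply transitive, then the action of $G$ on every $S_j$ is simply transitive, and the action of $\overline{G}$ on $\overline{S}$ is also simply transitive. (5) Suppose the action of $G$ on $S_1$ is simply transitive. Let $H$ be the centralizer of $G$ in $\mathrm{Sym}(S_1)$. Then $H$ is the Lewin dual group of $G$ (in $\mathrm{Sym}(S_1)$). Let $H$ act on $S_j$ via its embedded copy $f_jHf_j^{-1}\le\mathrm{Sym}(S_j)$ (so $h\in H$ acts on $S_j$ as $f_jhf_j^{-1}$), so that $f_j$ is $H$-equivariant, and regard $H$ as a subgroup of $\mathrm{Sym}(\overline{S})$ via $h\mapsto\bigsqcup_{j=1}^nf_jhf_j^{-1}$. Let $\overline{H}:=\langle H,\overline{f}\rangle\le\mathrm{Sym}(\overline{S})$. Then $\overline{H}$ is the centralizer of $\overline{G}$ in $\mathrm{Sym}(\overline{S})$, so $\overline{H}$ and $\overline{G}$ are (Lewin)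 dual groups in $\mathrm{Sym}(\overline{S})$. Moreover: (i) $\overline{f}$ is $H$-equivariant. (ii) $H$ and $\langle\overline{f}\rangle$ commute in $\mathrm{Sym}(\overline{S})$, and $\overline{H}$ is an internal direct product of $H$ and $\langle\overline{f}\rangle$. Moreover, $\overline{H}$ is the disjoint union $\overline{H}=H\cup\overline{f}H\cup\cdots\cup\overline{f}^{n-1}H=H\cup H\overline{f}\cup\cdots\cup H\overline{f}^{n-1}$, where $H$ is exactly the set of those transformations in $\overline{H}$ that preserve each $S_j$ for $1\le j\le n$, and the coset $\overline{f}^iH=H\overline{f}^i$ is exactly the set of those transformations in $\overline{H}$ that send $S_j$ to $S_{j+i}$ for all $1\le j\le n$ (indices read modulo $n$). (iii) There is a left split short exact sequence $\{Id_{\overline{S}}\}\to H\to\overline{H}\to\langle\overline{f}\rangle\to\{Id_{\overline{S}}\}$ with first map the inclusion and second map $h\overline{f}^i\mapsto\overline{f}^i$, which is therefore isomorphic to the direct product short exact sequence of $H$ and $\langle\overline{f}\rangle$. (iv) The action of $H$ on every $S_j$ is simply transitive, and the action of $\overline{H}$ on $\overline{S}$ is simply transitive. (6) Suppose again that the action of $G$ on $S_1$ is simply transitive, and let $H$ and its action on each $S_j$ be as in (5). Let $h\in H$ and let $\overline{h}=\bigsqcup_{j=1}^nf_jhf_j^{-1}$ be the extension of $h$ to $\overline{S}$. Then the function $\overline{f}\circ\overline{h}=\overline{h}\circ\overline{f}$ is $f_{j+1}hf_j^{-1}$ on $S_j$ (indices read modulo $n$).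
   Context: All group actions are left actions. An action of $G$ on $S$ is faithful if the induced homomorphism $G\to\mathrm{Sym}(S)$ is injective; it is simply transitive if for all $s,s'\in S$ there is a unique $g\in G$ with $gs=s'$. A map $f$ between $G$-sets is $G$-equivariant if $f(gs)=gf(s)$ for all $g$ and $s$. Two subgroups $G$ and $H$ of a symmetric group $\mathrm{Sym}(S)$ are dual in the sense of Lewin (Lewin dual, or simply dual) if each acts simply transitively on $S$ and each is the centralizer of the other in $\mathrm{Sym}(S)$. A short exact sequence $1\to A\to B\to C\to 1$ of groups is left split if the homomorphism $A\to B$ has a left inverse homomorphism $B\to A$. *)

theory Defs
  imports "HOL-Algebra.Algebra"
begin

text \<open>The symmetric group of a set \<open>S\<close> is \<^term>\<open>BijGroup S\<close>: its elements are the bijections of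
  \<open>S\<close> that are \<^const>\<open>undefined\<close> outside \<open>S\<close>, and its product is composition on \<open>S\<close>. A subgroup
  \<open>A\<close> of a group \<open>M\<close>, seen as a group, is \<open>M\<lparr>carrier := A\<rparr>\<close>; a subgroup of \<open>BijGroup S\<close> acts on
  \<open>S\<close> through \<open>\<lambda>t. t\<close>.\<close>

locale simply_transitive_action = group_action +
  assumes unique_transporter:
    "\<lbrakk> s \<in> E; s' \<in> E \<rbrakk> \<Longrightarrow> \<exists>!g. g \<in> carrier G \<and> \<phi> g s = s'"

definition equivariant ::
  "('g, 'm) monoid_scheme \<Rightarrow> 'a set \<Rightarrow> ('g \<Rightarrow> 'a \<Rightarrow> 'a) \<Rightarrow> 'b set \<Rightarrow> ('g \<Rightarrow> 'b \<Rightarrow> 'b) \<Rightarrow> ('a \<Rightarrow> 'b) \<Rightarrow> bool"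
  where "equivariant G E \<phi> E' \<psi> f \<longleftrightarrow>
    f \<in> E \<rightarrow> E' \<and> (\<forall>g\<in>carrier G. \<forall>s\<in>E. f (\<phi> g s) = \<psi> g (f s))"

definition centralizer :: "('a, 'm) monoid_scheme \<Rightarrow> 'a set \<Rightarrow> 'a set"
  where "centralizer M A = {x \<in> carrier M. \<forall>a\<in>A. x \<otimes>\<^bsub>M\<^esub> a = a \<otimes>\<^bsub>M\<^esub> x}"

definition lewin_dual :: "'a set \<Rightarrow> ('a \<Rightarrow> 'a) set \<Rightarrow> ('a \<Rightarrow> 'a) set \<Rightarrow> bool"
  where "lewin_dual S A B \<longleftrightarrow>
    subgroup A (BijGroup S) \<and> subgroup B (BijGroup S) \<and>
    simply_transitive_action (BijGroup S\<lparr>carrier := A\<rparr>) S (\<lambda>t. t) \<and>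
    simply_transitive_action (BijGroup S\<lparr>carrier := B\<rparr>) S (\<lambda>t. t) \<and>
    B = centralizer (BijGroup S) A \<and> A = centralizer (BijGroup S) B"

definition internal_direct_product :: "('a, 'm) monoid_scheme \<Rightarrow> 'a set \<Rightarrow> 'a set \<Rightarrow> bool"
  where "internal_direct_product K A B \<longleftrightarrow>
    A \<lhd> K \<and> B \<lhd> K \<and> A \<inter> B = {\<one>\<^bsub>K\<^esub>} \<and> A <#>\<^bsub>K\<^esub> B = carrier K"

text \<open>The library's \<open>short_exact_sequence C B A p i\<close> lists the groups and the maps from right to
  left: it stands for \<open>1 \<longrightarrow> A \<longrightarrow> B \<longrightarrow> C \<longrightarrow> 1\<close> with maps \<open>i\<close> from \<open>A\<close> to \<open>B\<close> and \<open>p\<close> from \<open>B\<close> to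
  \<open>C\<close>.\<close>

definition left_split ::
  "('a, 'm) monoid_scheme \<Rightarrow> ('b, 'l) monoid_scheme \<Rightarrow> ('a \<Rightarrow> 'b) \<Rightarrow> bool"
  where "left_split A B i \<longleftrightarrow> (\<exists>r\<in>hom B A. \<forall>a\<in>carrier A. r (i a) = a)"

text \<open>For a short exact sequence \<open>1 \<longrightarrow> A \<longrightarrow> B \<longrightarrow> C \<longrightarrow> 1\<close> with maps \<open>i\<close> and \<open>p\<close>: isomorphism, by a
  commuting ladder of group isomorphisms, with
  \<open>1 \<longrightarrow> A \<longrightarrow> A \<times> C \<longrightarrow> C \<longrightarrow> 1\<close>, whose maps are \<open>a \<mapsto> (a, 1)\<close> and \<open>(a, c) \<mapsto> c\<close>.\<close>

definition isomorphic_to_direct_product_sequence ::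
  "('a, 'm) monoid_scheme \<Rightarrow> ('b, 'l) monoid_scheme \<Rightarrow> ('c, 'k) monoid_scheme \<Rightarrow>
    ('a \<Rightarrow> 'b) \<Rightarrow> ('b \<Rightarrow> 'c) \<Rightarrow> bool"
  where "isomorphic_to_direct_product_sequence A B C i p \<longleftrightarrow>
    (\<exists>\<alpha>\<in>iso A A. \<exists>\<beta>\<in>iso B (A \<times>\<times> C). \<exists>\<gamma>\<in>iso C C.
      (\<forall>a\<in>carrier A. \<beta> (i a) = (\<alpha> a, \<one>\<^bsub>C\<^esub>)) \<and>
      (\<forall>b\<in>carrier B. \<gamma> (p b) = snd (\<beta> b)))"

text \<open>Reads an index \<open>k \<ge> 1\<close> modulo \<open>n\<close>, with representatives \<open>1, \<dots>, n\<close>.\<close>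

definition cyc :: "nat \<Rightarrow> nat \<Rightarrow> nat"
  where "cyc n k = Suc ((k - 1) mod n)"

definition total_set :: "nat \<Rightarrow> (nat \<Rightarrow> 'a set) \<Rightarrow> 'a set"
  where "total_set n S = (\<Union>j\<in>{1..n}. S j)"

text \<open>For pairwise disjoint \<open>S 1, \<dots>, S n\<close>: the map on their union that is \<open>F j\<close> on \<open>S j\<close>.\<close>

definition glue :: "nat \<Rightarrow> (nat \<Rightarrow> 'a set) \<Rightarrow> (nat \<Rightarrow> 'a \<Rightarrow> 'a) \<Rightarrow> 'a \<Rightarrow> 'a"
  where "glue n S F = (\<lambda>x\<in>total_set n S. F (THE j. j \<in> {1..n} \<and> x \<in> S j) x)"

lemma glue_apply:
  assumes disj: "disjoint_family_on S {1..n}" and assms: "j \<in> {1..n}" "x \<in> S j"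
  shows "glue n S F x = F j x"
proof -
  have "k = j" if "k \<in> {1..n} \<and> x \<in> S k" for k
    using disjoint_family_onD[OF disj, of k j] that assms by blast
  then have "(THE j. j \<in> {1..n} \<and> x \<in> S j) = j"
    using assms by (intro the_equality) auto
  then show ?thesis
    using assms by (auto simp: glue_def total_set_def)
qed

definition meta_rotation :: "nat \<Rightarrow> (nat \<Rightarrow> 'a set) \<Rightarrow> (nat \<Rightarrow> 'a \<Rightarrow> 'a) \<Rightarrow> 'a \<Rightarrow> 'a"
  where "meta_rotation n S f = glue n S (\<lambda>j. f (cyc n (j + 1)) \<circ> inv_into (S 1) (f j))"

definition union_action ::
  "nat \<Rightarrow> (nat \<Rightarrow> 'a set) \<Rightarrow> (nat \<Rightarrow> 'g \<Rightarrow> 'a \<Rightarrow> 'a) \<Rightarrow> 'g \<Rightarrow> 'a \<Rightarrow> 'a"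
  where "union_action n S \<phi> g = glue n S (\<lambda>j. \<phi> j g)"

text \<open>A permutation \<open>h\<close> of \<open>S 1\<close> acts on \<open>S j\<close> as \<open>f\<^sub>j h f\<^sub>j\<inverse>\<close>.\<close>

definition conj_action ::
  "(nat \<Rightarrow> 'a set) \<Rightarrow> (nat \<Rightarrow> 'a \<Rightarrow> 'a) \<Rightarrow> nat \<Rightarrow> ('a \<Rightarrow> 'a) \<Rightarrow> 'a \<Rightarrow> 'a"
  where "conj_action S f j h = (\<lambda>x\<in>S j. f j (h (inv_into (S 1) (f j) x)))"

end

theory Submission
  imports Defs
begin

text \<open>
  Put \<open>X = S\<^sub>1 \<squnion> \<dots> \<squnion> S\<^sub>n\<close>. The bijections \<open>f\<^sub>j\<close> identify \<open>X\<close> with \<open>{1, \<dots>, n} \<times> S\<^sub>1\<close>, the pair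
  \<open>(j, s)\<close> standing for \<open>f\<^sub>j s\<close>. In these coordinates the meta-rotation is
  \<open>(j, s) \<mapsto> (j + 1, s)\<close>, with \<open>j\<close> read modulo \<open>n\<close>, and a permutation \<open>h\<close> of \<open>S\<^sub>1\<close>, acting on \<open>S\<^sub>j\<close> as
  \<open>f\<^sub>j h f\<^sub>j\<inverse>\<close>, extends to the diagonal permutation \<open>(j, s) \<mapsto> (j, h s)\<close>. The two kinds of maps move
  different coordinates, so they commute, and the rotation has order \<open>n\<close>. Equivariance of the \<open>f\<^sub>j\<close> says
  that \<open>g \<in> G\<close> acts on \<open>X\<close> as the diagonal extension of its own action on \<open>S\<^sub>1\<close>
  (\<open>union_action_eq_diag\<close>). Hence \<open>G\<close> and \<open>H\<close> are treated alike: both are diagonal copies of a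
  subgroup \<open>K\<close> of \<open>Sym(S\<^sub>1)\<close>, and every structural claim is proved once, for the subgroup of
  \<open>Sym(X)\<close> generated by the diagonal copy of \<open>K\<close> and the rotation.

  For such a group (\<open>diag_rot_structure\<close>), an element is a product \<open>rot\<^sup>i \<cdot> diag h\<close>, and it carries \<open>S\<^sub>j\<close>
  onto \<open>S\<^sub>j\<^sub>+\<^sub>i\<close>. So the residue of \<open>i\<close> modulo \<open>n\<close> can be read off from the way the pieces are permuted;
  this makes the cosets disjoint, describes each of them by its effect on the pieces, and makes the
  two factors meet trivially. The exact sequence and its splitting then hold for
  any internal direct product (\<open>internal_direct_product_split_exact\<close>).

  The duality claims rest on one observation (\<open>commuting_transitive_subgroups_lewin_dual\<close>): if two
  permutation groups of a nonempty set commute elementwise and are both transitive, they are Lewin dual. For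
  a permutation commuting with a transitive group is determined by its value at a single point,
  and transitivity of the other group supplies an element with that value. For \<open>S\<^sub>1\<close> this needs
  the centralizer of a simply transitive group to be transitive
  (\<open>simply_transitive_action_lewin_dual\<close>); for \<open>X\<close> it only needs that the rotation joins the pieces
  (\<open>diag_rot_lewin_dual\<close>).
\<close>

section \<open>Internal direct products and split exact sequences\<close>

text \<open>Commutation of the factors makes \<open>(a, b) \<mapsto> a b\<close> an isomorphism from the external product \<open>A \<times> B\<close>.
  Under its inverse the two coordinate projections become the required maps: the second one has
  kernel \<open>A\<close>, and the first one splits the inclusion of \<open>A\<close>.\<close>

lemma internal_direct_product_split_exact:
  fixes K :: "'a monoid"
  assumes "group K" and idp: "internal_direct_product K A B"
  shows "\<exists>\<pi>. (\<forall>a\<in>A. \<forall>b\<in>B. \<pi> (a \<otimes>\<^bsub>K\<^esub> b) = b) \<and>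
    short_exact_sequence (K\<lparr>carrier := B\<rparr>) K (K\<lparr>carrier := A\<rparr>) \<pi> (\<lambda>x. x) \<and>
    left_split (K\<lparr>carrier := A\<rparr>) K (\<lambda>x. x) \<and>
    isomorphic_to_direct_product_sequence (K\<lparr>carrier := A\<rparr>) K (K\<lparr>carrier := B\<rparr>) (\<lambda>x. x) \<pi>"
proof -
  interpret group K by fact
  have normal: "A \<lhd> K" "B \<lhd> K" and Int: "A \<inter> B = {\<one>\<^bsub>K\<^esub>}" and AB: "A <#>\<^bsub>K\<^esub> B = carrier K"
    using idp by (auto simp: internal_direct_product_def)
  interpret A: subgroup A K using normal(1) by (rule normal_imp_subgroup)
  interpret B: subgroup B K using normal(2) by (rule normal_imp_subgroup)
  interpret group_disjoint_sum K A B ..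
  have comm: "a \<otimes>\<^bsub>K\<^esub> b = b \<otimes>\<^bsub>K\<^esub> a" if "a \<in> A" "b \<in> B" for a b
    using normal_imp_commuting[OF normal] Int that by auto
  let ?KA = "K\<lparr>carrier := A\<rparr>" and ?KB = "K\<lparr>carrier := B\<rparr>"
  have grA: "group ?KA" and grB: "group ?KB"
    using A.subgroup_is_group B.subgroup_is_group is_group by auto
  define m where "m = (\<lambda>(a, b). a \<otimes>\<^bsub>K\<^esub> b)"
  have "m \<in> hom (?KA \<times>\<times> ?KB) K"
  proof (rule homI)
    fix x y assume "x \<in> carrier (?KA \<times>\<times> ?KB)" "y \<in> carrier (?KA \<times>\<times> ?KB)"
    then obtain a b a' b' where xy: "x = (a, b)" "y = (a', b')"
      and in_AB: "a \<in> A" "b \<in> B" "a' \<in> A" "b' \<in> B" by auto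
    then have "a \<otimes>\<^bsub>K\<^esub> a' \<otimes>\<^bsub>K\<^esub> (b \<otimes>\<^bsub>K\<^esub> b') = a \<otimes>\<^bsub>K\<^esub> (a' \<otimes>\<^bsub>K\<^esub> b) \<otimes>\<^bsub>K\<^esub> b'"
      by (simp add: m_assoc)
    also have "\<dots> = a \<otimes>\<^bsub>K\<^esub> (b \<otimes>\<^bsub>K\<^esub> a') \<otimes>\<^bsub>K\<^esub> b'"
      using in_AB comm by simp
    also have "\<dots> = (a \<otimes>\<^bsub>K\<^esub> b) \<otimes>\<^bsub>K\<^esub> (a' \<otimes>\<^bsub>K\<^esub> b')"
      using in_AB by (simp add: m_assoc)
    finally show "m (x \<otimes>\<^bsub>?KA \<times>\<times> ?KB\<^esub> y) = m x \<otimes>\<^bsub>K\<^esub> m y"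
      using xy by (simp add: m_def)
  qed (auto simp: m_def)
  moreover have "bij_betw m (carrier (?KA \<times>\<times> ?KB)) (carrier K)"
  proof (rule bij_betw_imageI)
    have "\<forall>a\<in>A. \<forall>b\<in>B. \<forall>a'\<in>A. \<forall>b'\<in>B. a \<otimes>\<^bsub>K\<^esub> b = a' \<otimes>\<^bsub>K\<^esub> b' \<longrightarrow> a = a' \<and> b = b'"
      using cancel Int by simp
    then show "inj_on m (carrier (?KA \<times>\<times> ?KB))"
      by (simp add: inj_on_def m_def)
    show "m ` carrier (?KA \<times>\<times> ?KB) = carrier K"
      unfolding AB[symmetric] by (auto simp: m_def set_mult_def image_iff)
  qed
  ultimately have m_iso: "m \<in> iso (?KA \<times>\<times> ?KB) K"
    by (simp add: iso_def)
  define \<beta> where "\<beta> = inv_into (carrier (?KA \<times>\<times> ?KB)) m"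
  have \<beta>_iso: "\<beta> \<in> iso K (?KA \<times>\<times> ?KB)"
    unfolding \<beta>_def by (rule group.iso_set_sym[OF DirProd_group[OF grA grB] m_iso])
  have \<beta>_mult: "\<beta> (a \<otimes>\<^bsub>K\<^esub> b) = (a, b)" if "a \<in> A" "b \<in> B" for a b
    using inv_into_f_f[of m "carrier (?KA \<times>\<times> ?KB)" "(a, b)"] m_iso that
    by (simp add: \<beta>_def iso_def bij_betw_def m_def)
  have \<beta>_A: "\<beta> a = (a, \<one>\<^bsub>K\<^esub>)" if "a \<in> A" for a
    using \<beta>_mult[of a "\<one>\<^bsub>K\<^esub>"] that by simp
  have fst_hom: "fst \<circ> \<beta> \<in> hom K ?KA" and snd_hom: "snd \<circ> \<beta> \<in> hom K ?KB"
    using \<beta>_iso hom_pairwise by (auto simp: iso_def)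
  have kernel: "kernel K ?KB (snd \<circ> \<beta>) = A"
  proof (intro equalityI subsetI)
    fix x assume "x \<in> kernel K ?KB (snd \<circ> \<beta>)"
    then have x: "x \<in> carrier K" "snd (\<beta> x) = \<one>\<^bsub>K\<^esub>" by (auto simp: kernel_def)
    then obtain a b where "a \<in> A" "b \<in> B" "x = a \<otimes>\<^bsub>K\<^esub> b"
      using AB by (force simp: set_mult_def)
    with x show "x \<in> A" using \<beta>_mult by simp
  qed (auto simp: kernel_def \<beta>_A)
  have epi: "snd \<circ> \<beta> \<in> epi K ?KB"
  proof -
    have "B \<subseteq> (snd \<circ> \<beta>) ` carrier K"
    proof
      fix b assume "b \<in> B"
      then show "b \<in> (snd \<circ> \<beta>) ` carrier K"
        using \<beta>_mult[of "\<one>\<^bsub>K\<^esub>" b] by (intro image_eqI[of _ _ b]) auto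
    qed
    then show ?thesis
      using snd_hom by (auto simp: epi_def hom_def Pi_iff)
  qed
  have incl: "(\<lambda>x. x) \<in> hom ?KA K"
    by (rule homI) auto
  have "short_exact_sequence ?KB K ?KA (snd \<circ> \<beta>) (\<lambda>x. x)"
    using epi incl kernel snd_hom grA grB is_group
    by (auto simp: short_exact_sequence_iff mon_def group_hom_def group_hom_axioms_def)
  moreover have "left_split ?KA K (\<lambda>x. x)"
    unfolding left_split_def using fst_hom \<beta>_A by (intro bexI[of _ "fst \<circ> \<beta>"]) auto
  moreover have "isomorphic_to_direct_product_sequence ?KA K ?KB (\<lambda>x. x) (snd \<circ> \<beta>)"
    unfolding isomorphic_to_direct_product_sequence_def
    using \<beta>_iso \<beta>_A iso_set_refl
    by (intro bexI[of _ "\<lambda>x. x"] bexI[of _ \<beta>]) auto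
  moreover have "\<forall>a\<in>A. \<forall>b\<in>B. (snd \<circ> \<beta>) (a \<otimes>\<^bsub>K\<^esub> b) = b"
    using \<beta>_mult by simp
  ultimately show ?thesis by blast
qed

lemma (in group) subgroup_centralizer:
  assumes "A \<subseteq> carrier G"
  shows "subgroup (centralizer G A) G"
proof (rule subgroupI)
  show "centralizer G A \<subseteq> carrier G" by (auto simp: centralizer_def)
  show "centralizer G A \<noteq> {}"
    using assms by (auto simp: centralizer_def intro!: exI[of _ \<one>])
next
  fix x assume x: "x \<in> centralizer G A"
  have "inv x \<otimes> a = a \<otimes> inv x" if "a \<in> A" for a
  proof -
    have "a \<in> carrier G" "x \<in> carrier G" "x \<otimes> a = a \<otimes> x"
      using x that assms by (auto simp: centralizer_def)
    then show ?thesis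
      by (metis inv_closed inv_solve_left inv_solve_right m_assoc m_closed)
  qed
  then show "inv x \<in> centralizer G A"
    using x by (auto simp: centralizer_def)
next
  fix x y assume xy: "x \<in> centralizer G A" "y \<in> centralizer G A"
  have "x \<otimes> y \<otimes> a = a \<otimes> (x \<otimes> y)" if "a \<in> A" for a
  proof -
    have "a \<in> carrier G" "x \<in> carrier G" "y \<in> carrier G" "x \<otimes> a = a \<otimes> x" "y \<otimes> a = a \<otimes> y"
      using xy that assms by (auto simp: centralizer_def)
    then show ?thesis by (metis m_assoc)
  qed
  then show "x \<otimes> y \<in> centralizer G A"
    using xy by (auto simp: centralizer_def)
qed

text \<open>Both extensions from generators to generated subgroups are instances of the same fact: a centralizer
  is a subgroup, so it contains whatever its elements generate.\<close>

lemma (in group) generate_commute: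
  assumes "A \<subseteq> carrier G" "B \<subseteq> carrier G"
    and comm: "\<And>a b. a \<in> A \<Longrightarrow> b \<in> B \<Longrightarrow> a \<otimes> b = b \<otimes> a"
    and "x \<in> generate G A" "y \<in> generate G B"
  shows "x \<otimes> y = y \<otimes> x"
proof -
  have "A \<subseteq> centralizer G B"
    using assms by (auto simp: centralizer_def)
  then have "x \<in> centralizer G B"
    using generate_subgroup_incl[OF _ subgroup_centralizer] assms by blast
  then have "B \<subseteq> centralizer G {x}"
    using assms by (auto simp: centralizer_def)
  moreover have "x \<in> carrier G"
    using assms generate_in_carrier by blast
  ultimately have "y \<in> centralizer G {x}"
    using generate_subgroup_incl[OF _ subgroup_centralizer, of B "{x}"] assms by blast
  then show ?thesis
    by (simp add: centralizer_def)
qed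

lemma (in group) subgroup_set_mult_commuting:
  assumes A: "subgroup A G" and B: "subgroup B G"
    and comm: "\<And>a b. a \<in> A \<Longrightarrow> b \<in> B \<Longrightarrow> a \<otimes> b = b \<otimes> a"
  shows "subgroup (A <#> B) G"
proof -
  interpret A: subgroup A G by fact
  interpret B: subgroup B G by fact
  show ?thesis
  proof (rule subgroupI)
    show "A <#> B \<subseteq> carrier G"
      by (auto simp: set_mult_def)
    have "\<one> \<otimes> \<one> \<in> A <#> B"
      using A.one_closed B.one_closed unfolding set_mult_def by blast
    then show "A <#> B \<noteq> {}" by blast
  next
    fix x assume "x \<in> A <#> B"
    then obtain a b where "x = a \<otimes> b" "a \<in> A" "b \<in> B" by (auto simp: set_mult_def)
    then have "inv x = inv a \<otimes> inv b"
      using comm[of "inv a" "inv b"] by (simp add: inv_mult_group)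
    then show "inv x \<in> A <#> B"
      using \<open>a \<in> A\<close> \<open>b \<in> B\<close> by (auto simp: set_mult_def)
  next
    fix x y assume "x \<in> A <#> B" "y \<in> A <#> B"
    then obtain a b a' b' where *: "x = a \<otimes> b" "y = a' \<otimes> b'" "a \<in> A" "b \<in> B" "a' \<in> A" "b' \<in> B"
      by (auto simp: set_mult_def)
    then have "x \<otimes> y = a \<otimes> (b \<otimes> a') \<otimes> b'" by (simp add: m_assoc)
    also have "\<dots> = a \<otimes> (a' \<otimes> b) \<otimes> b'" using comm[of a' b] * by simp
    also have "\<dots> = (a \<otimes> a') \<otimes> (b \<otimes> b')" using * by (simp add: m_assoc)
    finally show "x \<otimes> y \<in> A <#> B"
      using * unfolding set_mult_def by blast
  qed
qed

lemma (in group) generate_commuting_union: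
  assumes A: "subgroup A G" and T: "T \<subseteq> carrier G"
    and comm: "\<And>a t. a \<in> A \<Longrightarrow> t \<in> T \<Longrightarrow> a \<otimes> t = t \<otimes> a"
  shows "generate G (A \<union> T) = A <#> generate G T"
proof -
  interpret A: subgroup A G by fact
  interpret T: subgroup "generate G T" G using T by (rule generate_is_subgroup)
  have gen_comm: "a \<otimes> t = t \<otimes> a" if "a \<in> A" "t \<in> generate G T" for a t
    using generate_commute[OF A.subset T comm] that generate.incl[of a A G] by blast
  show ?thesis
  proof (rule generateI[symmetric])
    show "subgroup (A <#> generate G T) G"
      using A T.subgroup_axioms gen_comm by (rule subgroup_set_mult_commuting)
    have "a \<in> A <#> generate G T" if "a \<in> A" for a
      using that unfolding set_mult_def
      by clarsimp (metis A.mem_carrier T.one_closed r_one)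
    moreover have "t \<in> A <#> generate G T" if "t \<in> T" for t
      using that T unfolding set_mult_def
      by clarsimp (metis A.one_closed generate.incl l_one subset_iff)
    ultimately show "A \<union> T \<subseteq> A <#> generate G T" by blast
  next
    fix K assume K: "subgroup K G" "A \<union> T \<subseteq> K"
    then have "generate G T \<subseteq> K" using generate_subgroup_incl by simp
    with K show "A <#> generate G T \<subseteq> K"
      by (auto simp: set_mult_def intro: subgroup.m_closed)
  qed
qed

lemma (in group) generate_singleton_finite_order:
  assumes x: "x \<in> carrier G" and ord: "0 < ord x"
  shows "generate G {x} = (\<lambda>i. x [^] i) ` {..<ord x}"
proof
  show "generate G {x} \<subseteq> (\<lambda>i. x [^] i) ` {..<ord x}"
  proof
    fix y assume "y \<in> generate G {x}"
    then obtain k :: int where y: "y = x [^] k"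
      using generate_pow[OF x] by auto
    have "x [^] k = x [^] (k mod int (ord x))"
      unfolding int_pow_eq[OF x] by (subst dvd_diff_commute) (rule dvd_minus_mod)
    also have "\<dots> = x [^] nat (k mod int (ord x))"
      using ord int_pow_int[of G x "nat (k mod int (ord x))"] by simp
    finally have "y = x [^] nat (k mod int (ord x))"
      using y by simp
    moreover have "nat (k mod int (ord x)) < ord x"
      using ord by (simp add: nat_less_iff)
    ultimately show "y \<in> (\<lambda>i. x [^] i) ` {..<ord x}" by blast
  qed
  show "(\<lambda>i. x [^] i) ` {..<ord x} \<subseteq> generate G {x}"
    using generate_pow[OF x] int_pow_int[of G x] by (auto simp flip: int_pow_int)
qed

lemma (in group) internal_direct_product_generate:
  assumes A: "subgroup A G" and T: "T \<subseteq> carrier G"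
    and comm: "\<And>a t. a \<in> A \<Longrightarrow> t \<in> T \<Longrightarrow> a \<otimes> t = t \<otimes> a"
    and triv: "A \<inter> generate G T \<subseteq> {\<one>}"
  shows "internal_direct_product (G\<lparr>carrier := generate G (A \<union> T)\<rparr>) A (generate G T)"
proof -
  interpret A: subgroup A G by fact
  define K where "K = generate G (A \<union> T)"
  have K: "subgroup K G"
    unfolding K_def using A.subset T by (intro generate_is_subgroup) auto
  have sub: "A \<subseteq> K" "generate G T \<subseteq> K"
    unfolding K_def using mono_generate[of T "A \<union> T"] by (auto intro: generate.incl)
  interpret KG: group "G\<lparr>carrier := K\<rparr>" using K by (rule subgroup_imp_group)
  interpret group_disjoint_sum "G\<lparr>carrier := K\<rparr>" A "generate G T"
    by (intro group_disjoint_sum.intro KG.is_group subgroup_incl K A sub generate_is_subgroup T)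
  have eq: "A <#>\<^bsub>G\<lparr>carrier := K\<rparr>\<^esub> generate G T = K"
    using generate_commuting_union[OF A T comm] by (simp add: K_def set_mult_def)
  have "a \<otimes> t = t \<otimes> a" if "a \<in> A" "t \<in> generate G T" for a t
    using generate_commute[OF A.subset T comm] that generate.incl[of a A G] by blast
  then have "A \<lhd> G\<lparr>carrier := K\<rparr>" "generate G T \<lhd> G\<lparr>carrier := K\<rparr>"
    using normal_eq_commuting eq triv by auto
  then show ?thesis
    using eq triv A.one_closed generate.one[of G T]
    unfolding internal_direct_product_def K_def[symmetric] by auto
qed

section \<open>Commuting transitive permutation groups\<close>

lemma BijGroup_mult_apply:
  assumes "a \<in> carrier (BijGroup S)" "b \<in> carrier (BijGroup S)" "x \<in> S"
  shows "(a \<otimes>\<^bsub>BijGroup S\<^esub> b) x = a (b x)"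
  using assms by (simp add: BijGroup_def compose_eq)

lemma BijGroup_one_apply: "x \<in> S \<Longrightarrow> \<one>\<^bsub>BijGroup S\<^esub> x = x"
  by (simp add: BijGroup_def)

lemma BijGroup_apply_mem: "a \<in> carrier (BijGroup S) \<Longrightarrow> x \<in> S \<Longrightarrow> a x \<in> S"
  using Bij_imp_funcset by (auto simp: BijGroup_def)

lemma BijGroup_eqI:
  assumes "a \<in> carrier (BijGroup S)" "b \<in> carrier (BijGroup S)" "\<And>x. x \<in> S \<Longrightarrow> a x = b x"
  shows "a = b"
  using assms by (auto simp: BijGroup_def intro: extensionalityI dest: Bij_imp_extensional)

lemma group_hom_subgroup_incl:
  assumes "group M" "subgroup A M"
  shows "group_hom (M\<lparr>carrier := A\<rparr>) M (\<lambda>t. t)"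
  using assms
  by (auto simp: group_hom_def group_hom_axioms_def hom_def group.subgroup_imp_group
      dest: subgroup.mem_carrier)

text \<open>If \<open>t\<close> commutes with a transitive \<open>B\<close>, its value at \<open>b x\<close> is \<open>b (t x)\<close>; so its value at the
  single point \<open>x\<close> determines it everywhere.\<close>

lemma commuting_transitive_imp_equal:
  assumes sub: "B \<subseteq> carrier (BijGroup S)" and t: "t \<in> carrier (BijGroup S)" "t' \<in> carrier (BijGroup S)"
    and trans: "\<And>x y. x \<in> S \<Longrightarrow> y \<in> S \<Longrightarrow> \<exists>b\<in>B. b x = y"
    and comm: "\<And>b. b \<in> B \<Longrightarrow> b \<otimes>\<^bsub>BijGroup S\<^esub> t = t \<otimes>\<^bsub>BijGroup S\<^esub> b"
      "\<And>b. b \<in> B \<Longrightarrow> b \<otimes>\<^bsub>BijGroup S\<^esub> t' = t' \<otimes>\<^bsub>BijGroup S\<^esub> b"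
    and x: "x \<in> S" "t x = t' x"
  shows "t = t'"
proof (rule BijGroup_eqI[OF t])
  fix y assume "y \<in> S"
  then obtain b where b: "b \<in> B" "b x = y" using trans x by blast
  then have "t y = (t \<otimes>\<^bsub>BijGroup S\<^esub> b) x"
    using BijGroup_mult_apply[of t S b x] t sub x by auto
  also have "\<dots> = b (t x)"
    using comm(1)[OF b(1)] BijGroup_mult_apply[of b S t x] t sub x b by auto
  also have "\<dots> = (b \<otimes>\<^bsub>BijGroup S\<^esub> t') x"
    using x BijGroup_mult_apply[of b S t' x] t sub x b by auto
  also have "\<dots> = t' y"
    using comm(2)[OF b(1)] BijGroup_mult_apply[of t' S b x] t sub x b by auto
  finally show "t y = t' y" .
qed

text \<open>The roles of \<open>A\<close> and \<open>B\<close> are symmetric, so it suffices to treat \<open>A\<close>. An element of the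
  centralizer of \<open>B\<close> agrees at a chosen point with some element of the transitive group \<open>A\<close>, hence
  equals it; the same rigidity gives uniqueness of the element of \<open>A\<close> carrying one point to another.\<close>

lemma commuting_transitive_subgroups_lewin_dual:
  assumes S: "S \<noteq> {}"
    and A: "subgroup A (BijGroup S)" and B: "subgroup B (BijGroup S)"
    and comm: "\<And>a b. a \<in> A \<Longrightarrow> b \<in> B \<Longrightarrow> a \<otimes>\<^bsub>BijGroup S\<^esub> b = b \<otimes>\<^bsub>BijGroup S\<^esub> a"
    and transA: "\<And>x y. x \<in> S \<Longrightarrow> y \<in> S \<Longrightarrow> \<exists>a\<in>A. a x = y"
    and transB: "\<And>x y. x \<in> S \<Longrightarrow> y \<in> S \<Longrightarrow> \<exists>b\<in>B. b x = y"
  shows "lewin_dual S A B"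
proof -
  have half: "simply_transitive_action (BijGroup S\<lparr>carrier := A\<rparr>) S (\<lambda>t. t) \<and>
      A = centralizer (BijGroup S) B"
    if A: "subgroup A (BijGroup S)" and B: "subgroup B (BijGroup S)"
      and comm: "\<And>a b. a \<in> A \<Longrightarrow> b \<in> B \<Longrightarrow> a \<otimes>\<^bsub>BijGroup S\<^esub> b = b \<otimes>\<^bsub>BijGroup S\<^esub> a"
      and transA: "\<And>x y. x \<in> S \<Longrightarrow> y \<in> S \<Longrightarrow> \<exists>a\<in>A. a x = y"
      and transB: "\<And>x y. x \<in> S \<Longrightarrow> y \<in> S \<Longrightarrow> \<exists>b\<in>B. b x = y" for A B
  proof
    have subA: "A \<subseteq> carrier (BijGroup S)" and subB: "B \<subseteq> carrier (BijGroup S)"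
      using A B by (auto dest: subgroup.subset)
    have eq: "t = a"
      if "a \<in> A" "t \<in> centralizer (BijGroup S) B" "x \<in> S" "t x = a x" for t a x
      using commuting_transitive_imp_equal[OF subB, of t a x] that transB comm subA
      by (auto simp: centralizer_def)
    show AC: "A = centralizer (BijGroup S) B"
    proof
      show "A \<subseteq> centralizer (BijGroup S) B"
        using subA comm by (auto simp: centralizer_def)
      show "centralizer (BijGroup S) B \<subseteq> A"
      proof
        fix t assume t: "t \<in> centralizer (BijGroup S) B"
        obtain x where x: "x \<in> S" using S by blast
        then have "t x \<in> S"
          using t by (auto simp: centralizer_def intro: BijGroup_apply_mem)
        then obtain a where "a \<in> A" "a x = t x" using transA x by blast
        then show "t \<in> A" using eq[OF _ t x] by metis
      qed
    qed
    show "simply_transitive_action (BijGroup S\<lparr>carrier := A\<rparr>) S (\<lambda>t. t)"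
    proof (intro simply_transitive_action.intro group_action.intro simply_transitive_action_axioms.intro)
      show "group_hom (BijGroup S\<lparr>carrier := A\<rparr>) (BijGroup S) (\<lambda>t. t)"
        using group_BijGroup A by (rule group_hom_subgroup_incl)
      fix x y assume "x \<in> S" "y \<in> S"
      moreover from this obtain a where "a \<in> A" "a x = y" using transA by blast
      ultimately show "\<exists>!g. g \<in> carrier (BijGroup S\<lparr>carrier := A\<rparr>) \<and> g x = y"
        using eq[folded AC] by (intro ex1I[of _ a]) auto
    qed
  qed
  show ?thesis
    unfolding lewin_dual_def
    using half[OF A B comm transA transB] half[OF B A comm[symmetric] transB transA] A B by blast
qed

text \<open>Choosing a base point \<open>s\<close> identifies \<open>E\<close> with \<open>G\<close> through \<open>g \<mapsto> g s\<close>, and the action becomes left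
  multiplication. Right multiplications commute with it and are transitive: the one moving \<open>s\<close>
  to \<open>s'\<close> is the map \<open>g s \<mapsto> g s'\<close>.\<close>

lemma simply_transitive_action_lewin_dual:
  assumes E: "E \<noteq> {}" and st: "simply_transitive_action G E \<phi>"
  shows "lewin_dual E (\<phi> ` carrier G) (centralizer (BijGroup E) (\<phi> ` carrier G))"
proof -
  interpret simply_transitive_action G E \<phi> by fact
  interpret group_hom G "BijGroup E" \<phi> by (rule group_hom)
  have orbit_bij: "bij_betw (\<lambda>g. \<phi> g s) (carrier G) E" if s: "s \<in> E" for s
  proof (rule bij_betw_imageI)
    show "inj_on (\<lambda>g. \<phi> g s) (carrier G)"
      using unique_transporter[OF s] element_image[OF _ s refl]
      by (intro inj_onI) (metis (no_types, lifting))
    show "(\<lambda>g. \<phi> g s) ` carrier G = E"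
      using unique_transporter[OF s] element_image[OF _ s refl] by blast
  qed
  have sub: "\<phi> ` carrier G \<subseteq> carrier (BijGroup E)" by auto
  show ?thesis
  proof (rule commuting_transitive_subgroups_lewin_dual[OF E])
    show "subgroup (\<phi> ` carrier G) (BijGroup E)" by (rule img_is_subgroup)
    show "subgroup (centralizer (BijGroup E) (\<phi> ` carrier G)) (BijGroup E)"
      using sub by (rule H.subgroup_centralizer)
    show "a \<otimes>\<^bsub>BijGroup E\<^esub> b = b \<otimes>\<^bsub>BijGroup E\<^esub> a"
      if "a \<in> \<phi> ` carrier G" "b \<in> centralizer (BijGroup E) (\<phi> ` carrier G)" for a b
      using that by (auto simp: centralizer_def)
    show "\<exists>a\<in>\<phi> ` carrier G. a x = y" if "x \<in> E" "y \<in> E" for x y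
      using unique_transporter[OF that] by blast
  next
    fix s s' assume s: "s \<in> E" "s' \<in> E"
    \<comment> \<open>\<open>\<tau> x\<close> is the group element carrying \<open>s\<close> to \<open>x\<close>\<close>
    define \<tau> where "\<tau> = inv_into (carrier G) (\<lambda>g. \<phi> g s)"
    define h where "h = (\<lambda>x\<in>E. \<phi> (\<tau> x) s')"
    have \<tau>_bij: "bij_betw \<tau> E (carrier G)"
      unfolding \<tau>_def using orbit_bij[OF s(1)] by (rule bij_betw_inv_into)
    have \<tau>: "\<tau> (\<phi> g s) = g" if "g \<in> carrier G" for g
      unfolding \<tau>_def using orbit_bij[OF s(1)] that inv_into_f_f[of "\<lambda>g. \<phi> g s" "carrier G" g]
      by (simp add: bij_betw_def)
    have h: "h (\<phi> g s) = \<phi> g s'" if "g \<in> carrier G" for g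
      using element_image[OF that s(1) refl] \<tau>[OF that] by (simp add: h_def)
    have "bij_betw ((\<lambda>g. \<phi> g s') \<circ> \<tau>) E E"
      using \<tau>_bij orbit_bij[OF s(2)] by (rule bij_betw_trans)
    then have "bij_betw h E E"
      by (rule bij_betw_cong[THEN iffD1, rotated]) (simp add: h_def)
    then have h_carrier: "h \<in> carrier (BijGroup E)"
      by (auto simp: BijGroup_def Bij_def h_def)
    have "h \<otimes>\<^bsub>BijGroup E\<^esub> \<phi> g = \<phi> g \<otimes>\<^bsub>BijGroup E\<^esub> h" if g: "g \<in> carrier G" for g
    proof (rule BijGroup_eqI[of _ E])
      fix x assume x: "x \<in> E"
      then obtain k where k: "k \<in> carrier G" "x = \<phi> k s"
        using unique_transporter[OF s(1) x] by blast
      have "(h \<otimes>\<^bsub>BijGroup E\<^esub> \<phi> g) x = h (\<phi> g (\<phi> k s))"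
        using BijGroup_mult_apply[OF h_carrier _ x] g k by simp
      also have "\<dots> = h (\<phi> (g \<otimes>\<^bsub>G\<^esub> k) s)"
        using composition_rule[OF s(1) g k(1)] by simp
      also have "\<dots> = \<phi> g (\<phi> k s')"
        using h[of "g \<otimes>\<^bsub>G\<^esub> k"] g k(1) composition_rule[OF s(2) g k(1)] by (simp del: hom_mult)
      also have "\<dots> = (\<phi> g \<otimes>\<^bsub>BijGroup E\<^esub> h) x"
        using BijGroup_mult_apply[OF _ h_carrier x] g k h by simp
      finally show "(h \<otimes>\<^bsub>BijGroup E\<^esub> \<phi> g) x = (\<phi> g \<otimes>\<^bsub>BijGroup E\<^esub> h) x" .
    qed (use g h_carrier in auto)
    then have "h \<in> centralizer (BijGroup E) (\<phi> ` carrier G)"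
      using h_carrier by (auto simp: centralizer_def)
    moreover have "h s = s'"
      using h[of "\<one>\<^bsub>G\<^esub>"] id_eq_one s by (metis G.one_closed restrict_apply')
    ultimately show "\<exists>b\<in>centralizer (BijGroup E) (\<phi> ` carrier G). b s = s'" by blast
  qed
qed

lemma simply_transitive_action_iff:
  assumes "group_action G E \<phi>"
  shows "simply_transitive_action G E \<phi> \<longleftrightarrow>
    (\<forall>s\<in>E. \<forall>s'\<in>E. \<exists>!g. g \<in> carrier G \<and> \<phi> g s = s')"
  using assms
  unfolding simply_transitive_action_def simply_transitive_action_axioms_def Ball_def by blast

lemma simply_transitive_action_transport:
  assumes act: "group_action G E \<phi>" "group_action G E' \<psi>"
    and bij: "bij_betw f E E'" and eqv: "equivariant G E \<phi> E' \<psi> f"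
  shows "simply_transitive_action G E \<phi> \<longleftrightarrow> simply_transitive_action G E' \<psi>"
proof -
  have img: "f ` E = E'" and inj: "inj_on f E" using bij by (auto simp: bij_betw_def)
  have iff: "\<psi> g (f s) = f s' \<longleftrightarrow> \<phi> g s = s'" if "g \<in> carrier G" "s \<in> E" "s' \<in> E" for g s s'
  proof -
    have "\<phi> g s \<in> E" using group_action.element_image[OF act(1)] that by blast
    then show ?thesis
      using eqv that inj_on_eq_iff[OF inj, of "\<phi> g s" s'] by (auto simp: equivariant_def)
  qed
  have eq: "(\<exists>!g. g \<in> carrier G \<and> \<psi> g (f s) = f s') \<longleftrightarrow> (\<exists>!g. g \<in> carrier G \<and> \<phi> g s = s')"
    if "s \<in> E" "s' \<in> E" for s s'
    using iff[OF _ that] by (metis (no_types, lifting))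
  show ?thesis
    unfolding simply_transitive_action_iff[OF act(1)] simply_transitive_action_iff[OF act(2)]
    unfolding img[symmetric]
    using eq by (simp only: ball_simps cong: ball_cong)
qed

section \<open>Arithmetic of cyclic indices\<close>

lemma cyc_mem: "1 \<le> n \<Longrightarrow> cyc n k \<in> {1..n}"
  by (simp add: cyc_def Suc_le_eq)

lemma cyc_id: "j \<in> {1..n} \<Longrightarrow> cyc n j = j"
  by (auto simp: cyc_def)

lemma cyc_cyc_add:
  assumes "1 \<le> a"
  shows "cyc n (cyc n a + b) = cyc n (a + b)"
proof -
  have "a + b - 1 = a - 1 + b" using assms by simp
  then show ?thesis by (simp add: cyc_def mod_add_left_eq)
qed

lemma cyc_add_eq_iff:
  assumes "1 \<le> j"
  shows "cyc n (j + i) = cyc n (j + k) \<longleftrightarrow> i mod n = k mod n"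
proof -
  have "j + i - 1 = j - 1 + i" "j + k - 1 = j - 1 + k" using assms by auto
  moreover have "(c + i) mod n = (c + k) mod n \<longleftrightarrow> i mod n = k mod n" for c
  proof -
    have "(int c + int i) mod int n = (int c + int k) mod int n \<longleftrightarrow> int i mod int n = int k mod int n"
      by (simp add: mod_eq_dvd_iff)
    then show ?thesis
      by (metis of_nat_add of_nat_eq_iff zmod_int)
  qed
  ultimately show ?thesis by (simp add: cyc_def)
qed

section \<open>Copies of a set indexed by a cycle\<close>

text \<open>The data of the theorem without a group: \<open>n\<close> pairwise disjoint copies of the nonempty set
  \<open>S 1\<close>. The map \<open>f 1\<close> may be any permutation of \<open>S 1\<close>, so that all indices enter
  in the same way.\<close>

locale disjoint_copies =
  fixes n :: nat and S :: "nat \<Rightarrow> 'a set" and f :: "nat \<Rightarrow> 'a \<Rightarrow> 'a"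
  assumes n: "1 \<le> n"
    and nonempty: "S 1 \<noteq> {}"
    and disjoint: "disjoint_family_on S {1..n}"
    and f_bij: "j \<in> {1..n} \<Longrightarrow> bij_betw (f j) (S 1) (S j)"
begin

abbreviation Sym where "Sym \<equiv> BijGroup (total_set n S)"
abbreviation rot where "rot \<equiv> meta_rotation n S f"
abbreviation diag where "diag \<equiv> union_action n S (conj_action S f)"

sublocale Sym: group Sym
  by (rule group_BijGroup)

lemma f_mem: "j \<in> {1..n} \<Longrightarrow> s \<in> S 1 \<Longrightarrow> f j s \<in> S j"
  using f_bij bij_betwE by blast

lemma f_mem_total: "j \<in> {1..n} \<Longrightarrow> s \<in> S 1 \<Longrightarrow> f j s \<in> total_set n S"
  using f_mem unfolding total_set_def by blast

lemma inv_into_f: "j \<in> {1..n} \<Longrightarrow> s \<in> S 1 \<Longrightarrow> inv_into (S 1) (f j) (f j s) = s"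
  using f_bij by (auto simp: bij_betw_def inv_into_f_f)

lemma S_cases:
  assumes "j \<in> {1..n}" "x \<in> S j"
  obtains s where "s \<in> S 1" "x = f j s"
  using assms f_bij by (auto simp: bij_betw_def)

lemma total_set_cases:
  assumes "x \<in> total_set n S"
  obtains j s where "j \<in> {1..n}" "s \<in> S 1" "x = f j s"
  using assms S_cases unfolding total_set_def by (metis UN_E)

lemma S_eq_iff:
  assumes "j \<in> {1..n}" "k \<in> {1..n}"
  shows "S j = S k \<longleftrightarrow> j = k"
proof -
  obtain s where "s \<in> S 1" using nonempty by blast
  then have "f j s \<in> S j" using assms f_mem by blast
  then show ?thesis using disjoint_family_onD[OF disjoint assms] by auto
qed

text \<open>With \<open>total_set_cases\<close>: every point of the union has unique coordinates \<open>(j, s)\<close>.\<close>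

lemma f_eq_iff:
  assumes "j \<in> {1..n}" "k \<in> {1..n}" "s \<in> S 1" "t \<in> S 1"
  shows "f j s = f k t \<longleftrightarrow> j = k \<and> s = t"
proof
  assume eq: "f j s = f k t"
  then have "j = k"
    using disjoint_family_onD[OF disjoint assms(1,2)] f_mem[OF assms(1,3)] f_mem[OF assms(2,4)] by auto
  then show "j = k \<and> s = t"
    using eq assms(3,4) inj_onD[OF bij_betw_imp_inj_on[OF f_bij[OF assms(1)]], of s t] by simp
qed simp

lemma Sym_eqI:
  assumes "a \<in> carrier Sym" "b \<in> carrier Sym"
    and "\<And>j s. j \<in> {1..n} \<Longrightarrow> s \<in> S 1 \<Longrightarrow> a (f j s) = b (f j s)"
  shows "a = b"
  using assms by (intro BijGroup_eqI[of a _ b]) (auto elim: total_set_cases)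

text \<open>Permuting the copies and permuting \<open>S 1\<close> independently gives a permutation of the union. The rotation
  is the case where \<open>h\<close> is the identity, a diagonal map the case where \<open>p\<close> is.\<close>

lemma SymI:
  assumes ext: "u \<in> extensional (total_set n S)"
    and p: "bij_betw p {1..n} {1..n}" and h: "bij_betw h (S 1) (S 1)"
    and u: "\<And>j s. j \<in> {1..n} \<Longrightarrow> s \<in> S 1 \<Longrightarrow> u (f j s) = f (p j) (h s)"
  shows "u \<in> carrier Sym"
proof -
  have p_mem: "p j \<in> {1..n}" if "j \<in> {1..n}" for j using p that bij_betwE by blast
  have h_mem: "h s \<in> S 1" if "s \<in> S 1" for s using h that bij_betwE by blast
  have "bij_betw u (total_set n S) (total_set n S)"
  proof (rule bij_betw_imageI)
    show "inj_on u (total_set n S)"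
    proof (rule inj_onI)
      fix x y assume "x \<in> total_set n S" "y \<in> total_set n S" and eq: "u x = u y"
      then obtain j s k t where jk: "j \<in> {1..n}" "k \<in> {1..n}" and st: "s \<in> S 1" "t \<in> S 1"
        and xy: "x = f j s" "y = f k t"
        by (metis total_set_cases)
      then have "p j = p k" "h s = h t"
        using eq u f_eq_iff[OF p_mem p_mem h_mem h_mem, OF jk st] by auto
      then show "x = y"
        using xy jk st p h by (auto simp: bij_betw_def inj_on_eq_iff)
    qed
    show "u ` total_set n S = total_set n S"
    proof (intro equalityI subsetI)
      fix y assume "y \<in> u ` total_set n S"
      then obtain j s where "j \<in> {1..n}" "s \<in> S 1" "y = u (f j s)"
        by (auto elim: total_set_cases)
      then show "y \<in> total_set n S" using u p_mem h_mem f_mem_total by simp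
    next
      fix y assume "y \<in> total_set n S"
      then obtain k t where kt: "k \<in> {1..n}" "t \<in> S 1" "y = f k t" by (rule total_set_cases)
      then obtain j s where js: "j \<in> {1..n}" "s \<in> S 1" "k = p j" "t = h s"
        using p h unfolding bij_betw_def by blast
      then have "y = u (f j s)" using u kt by simp
      then show "y \<in> u ` total_set n S" using f_mem_total js by blast
    qed
  qed
  then show ?thesis
    using ext by (simp add: BijGroup_def Bij_def)
qed

lemma rot_apply:
  assumes "j \<in> {1..n}" "s \<in> S 1"
  shows "rot (f j s) = f (cyc n (j + 1)) s"
  unfolding meta_rotation_def
  using glue_apply[OF disjoint assms(1) f_mem[OF assms]] inv_into_f[OF assms] by simp

lemma diag_apply:
  assumes "j \<in> {1..n}" "s \<in> S 1"
  shows "diag h (f j s) = f j (h s)"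
  unfolding union_action_def
  using glue_apply[OF disjoint assms(1) f_mem[OF assms]] f_mem[OF assms] inv_into_f[OF assms]
  by (simp add: conj_action_def)

lemma rot_mem: "rot \<in> carrier Sym"
proof (rule SymI)
  have "inj_on (\<lambda>j. cyc n (j + 1)) {1..n}"
  proof (rule inj_onI)
    fix j k assume jk: "j \<in> {1..n}" "k \<in> {1..n}" and "cyc n (j + 1) = cyc n (k + 1)"
    then have "cyc n (1 + j) = cyc n (1 + k)" by (simp add: add.commute)
    then have "j mod n = k mod n" by (simp only: cyc_add_eq_iff)
    then have "cyc n (1 + (j - 1)) = cyc n (1 + (k - 1))"
      unfolding cyc_add_eq_iff[OF order_refl] using jk
      by (cases "j = n"; cases "k = n") auto
    then show "j = k" using jk cyc_id[OF jk(1)] cyc_id[OF jk(2)] by simp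
  qed
  moreover have "(\<lambda>j. cyc n (j + 1)) ` {1..n} \<subseteq> {1..n}"
    using cyc_mem[OF n] by blast
  ultimately show "bij_betw (\<lambda>j. cyc n (j + 1)) {1..n} {1..n}"
    by (simp add: bij_betw_def endo_inj_surj)
  show "rot \<in> extensional (total_set n S)"
    by (simp add: meta_rotation_def glue_def)
  show "bij_betw (\<lambda>s. s) (S 1) (S 1)" by (simp add: bij_betw_def)
qed (rule rot_apply)

lemma diag_mem:
  assumes "h \<in> carrier (BijGroup (S 1))"
  shows "diag h \<in> carrier Sym"
proof (rule SymI)
  show "diag h \<in> extensional (total_set n S)"
    by (simp add: union_action_def glue_def)
  show "bij_betw h (S 1) (S 1)" using assms by (simp add: BijGroup_def Bij_def)
  show "bij_betw (\<lambda>j. j) {1..n} {1..n}" by (simp add: bij_betw_def)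
qed (rule diag_apply)

lemma diag_hom: "group_hom (BijGroup (S 1)) Sym diag"
proof (intro group_hom.intro group_hom_axioms.intro homI group_BijGroup diag_mem)
  fix g h assume gh: "g \<in> carrier (BijGroup (S 1))" "h \<in> carrier (BijGroup (S 1))"
  then have "g \<otimes>\<^bsub>BijGroup (S 1)\<^esub> h \<in> carrier (BijGroup (S 1))"
    by (rule monoid.m_closed[OF group.is_monoid[OF group_BijGroup]])
  then show "diag (g \<otimes>\<^bsub>BijGroup (S 1)\<^esub> h) = diag g \<otimes>\<^bsub>Sym\<^esub> diag h"
    using gh
    by (intro Sym_eqI)
      (simp_all add: diag_mem diag_apply BijGroup_mult_apply BijGroup_apply_mem f_mem_total)
qed

lemma diag_inj: "inj_on diag (carrier (BijGroup (S 1)))"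
proof (rule inj_onI)
  fix g h assume gh: "g \<in> carrier (BijGroup (S 1))" "h \<in> carrier (BijGroup (S 1))" "diag g = diag h"
  show "g = h"
  proof (rule BijGroup_eqI[OF gh(1,2)])
    fix s assume s: "s \<in> S 1"
    have one: "1 \<in> {1..n}" using n by simp
    have "f 1 (g s) = f 1 (h s)"
      using diag_apply[OF one s] gh(3) by metis
    then show "g s = h s"
      using f_eq_iff[OF one one] gh s BijGroup_apply_mem by metis
  qed
qed

lemma diag_rot_commute:
  assumes "h \<in> carrier (BijGroup (S 1))"
  shows "diag h \<otimes>\<^bsub>Sym\<^esub> rot = rot \<otimes>\<^bsub>Sym\<^esub> diag h"
  using assms
  by (intro Sym_eqI)
    (simp_all add: diag_mem rot_mem diag_apply rot_apply BijGroup_mult_apply BijGroup_apply_mem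
      f_mem_total cyc_mem[OF n, simplified])

lemma rot_pow_apply:
  assumes "j \<in> {1..n}" "s \<in> S 1"
  shows "(rot [^]\<^bsub>Sym\<^esub> i) (f j s) = f (cyc n (j + i)) s"
proof (induction i)
  case 0
  then show ?case
    using f_mem_total[OF assms] cyc_id[OF assms(1)] by (simp add: BijGroup_one_apply)
next
  case (Suc i)
  have "(rot [^]\<^bsub>Sym\<^esub> Suc i) (f j s) = (rot \<otimes>\<^bsub>Sym\<^esub> rot [^]\<^bsub>Sym\<^esub> i) (f j s)"
    using Sym.nat_pow_Suc2[OF rot_mem] by simp
  also have "\<dots> = rot (f (cyc n (j + i)) s)"
    using Suc f_mem_total[OF assms] rot_mem by (simp add: BijGroup_mult_apply)
  also have "\<dots> = f (cyc n (cyc n (j + i) + 1)) s"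
    using cyc_mem[OF n] assms(2) by (rule rot_apply)
  also have "cyc n (cyc n (j + i) + 1) = cyc n (j + Suc i)"
    using cyc_cyc_add[of "j + i" n 1] assms(1) by simp
  finally show ?case .
qed

text \<open>Evaluation at a point of the first copy recovers the exponent modulo \<open>n\<close>.\<close>

lemma rot_pow_eq_iff: "rot [^]\<^bsub>Sym\<^esub> i = rot [^]\<^bsub>Sym\<^esub> k \<longleftrightarrow> i mod n = k mod n"
proof
  assume "i mod n = k mod n"
  then have "cyc n (j + i) = cyc n (j + k)" if "j \<in> {1..n}" for j
    using cyc_add_eq_iff that by simp
  then show "rot [^]\<^bsub>Sym\<^esub> i = rot [^]\<^bsub>Sym\<^esub> k"
    by (intro Sym_eqI) (simp_all add: rot_mem rot_pow_apply)
next
  assume eq: "rot [^]\<^bsub>Sym\<^esub> i = rot [^]\<^bsub>Sym\<^esub> k"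
  obtain s where s: "s \<in> S 1" using nonempty by blast
  have "1 \<in> {1..n}" using n by simp
  then have "f (cyc n (1 + i)) s = f (cyc n (1 + k)) s"
    using rot_pow_apply[of 1 s] s eq by metis
  then have "cyc n (1 + i) = cyc n (1 + k)"
    using f_eq_iff[OF cyc_mem[OF n] cyc_mem[OF n] s s] by blast
  then show "i mod n = k mod n" by (simp only: cyc_add_eq_iff)
qed

lemma ord_rot: "Sym.ord rot = n"
  using rot_pow_eq_iff[of _ 0] by (simp add: Sym.ord_unique rot_mem mod_eq_0_iff_dvd)

lemma generate_rot: "generate Sym {rot} = (\<lambda>i. rot [^]\<^bsub>Sym\<^esub> i) ` {..<n}"
  using Sym.generate_singleton_finite_order[OF rot_mem] ord_rot n by simp

lemma rot_pow_mem_generate: "rot [^]\<^bsub>Sym\<^esub> (i::nat) \<in> generate Sym {rot}"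
  using rot_pow_eq_iff[of i "i mod n"] n unfolding generate_rot by (intro image_eqI[of _ _ "i mod n"]) auto

lemma rot_pow_diag_image:
  assumes h: "h \<in> carrier (BijGroup (S 1))" and j: "j \<in> {1..n}"
  shows "(rot [^]\<^bsub>Sym\<^esub> i \<otimes>\<^bsub>Sym\<^esub> diag h) ` S j = S (cyc n (j + i))"
proof -
  have S: "S j = f j ` S 1" "S (cyc n (j + i)) = f (cyc n (j + i)) ` S 1" "h ` S 1 = S 1"
    using f_bij[OF j] f_bij[OF cyc_mem[OF n]] h by (auto simp: bij_betw_def BijGroup_def Bij_def)
  have "(rot [^]\<^bsub>Sym\<^esub> i \<otimes>\<^bsub>Sym\<^esub> diag h) (f j s) = f (cyc n (j + i)) (h s)" if s: "s \<in> S 1" for s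
    using j s h BijGroup_apply_mem[OF h s]
    by (simp add: BijGroup_mult_apply diag_mem rot_mem f_mem_total diag_apply rot_pow_apply)
  then have "(rot [^]\<^bsub>Sym\<^esub> i \<otimes>\<^bsub>Sym\<^esub> diag h) ` S j = f (cyc n (j + i)) ` h ` S 1"
    unfolding S(1) image_image by (rule image_cong[OF refl])
  then show ?thesis using S by simp
qed

text \<open>The shift \<open>j \<mapsto> j + i\<close> that an element induces on the pieces is constant on the coset of
  \<open>rot\<^sup>i\<close> and, since the pieces are nonempty and disjoint, determines \<open>i\<close> modulo \<open>n\<close>: the image
  of \<open>S 1\<close> alone suffices. Disjointness of the cosets, their description inside the
  group, and the trivial intersection of the two factors all come from this.\<close>

lemma diag_rot_structure:
  assumes K: "subgroup K (BijGroup (S 1))"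
  defines "A \<equiv> diag ` K" and "F \<equiv> generate Sym {rot}" and "Kbar \<equiv> generate Sym (diag ` K \<union> {rot})"
  shows "\<forall>a\<in>A. \<forall>b\<in>F. a \<otimes>\<^bsub>Sym\<^esub> b = b \<otimes>\<^bsub>Sym\<^esub> a"
    and "internal_direct_product (Sym\<lparr>carrier := Kbar\<rparr>) A F"
    and "Kbar = (\<Union>i<n. (rot [^]\<^bsub>Sym\<^esub> i) <#\<^bsub>Sym\<^esub> A)"
    and "disjoint_family_on (\<lambda>i. (rot [^]\<^bsub>Sym\<^esub> i) <#\<^bsub>Sym\<^esub> A) {..<n}"
    and "Kbar = (\<Union>i<n. A #>\<^bsub>Sym\<^esub> (rot [^]\<^bsub>Sym\<^esub> i))"
    and "disjoint_family_on (\<lambda>i. A #>\<^bsub>Sym\<^esub> (rot [^]\<^bsub>Sym\<^esub> i)) {..<n}"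
    and "A = {t \<in> Kbar. \<forall>j\<in>{1..n}. t ` S j = S j}"
    and "\<forall>i::nat. (rot [^]\<^bsub>Sym\<^esub> i) <#\<^bsub>Sym\<^esub> A = A #>\<^bsub>Sym\<^esub> (rot [^]\<^bsub>Sym\<^esub> i) \<and>
      (rot [^]\<^bsub>Sym\<^esub> i) <#\<^bsub>Sym\<^esub> A = {t \<in> Kbar. \<forall>j\<in>{1..n}. t ` S j = S (cyc n (j + i))}"
proof -
  interpret diag: group_hom "BijGroup (S 1)" Sym diag by (rule diag_hom)
  have A: "subgroup A Sym" unfolding A_def using K by (rule diag.subgroup_img_is_subgroup)
  then interpret A: subgroup A Sym .
  have KD: "h \<in> carrier (BijGroup (S 1))" if "h \<in> K" for h
    using that subgroup.subset[OF K] by blast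
  have comm_rot: "a \<otimes>\<^bsub>Sym\<^esub> t = t \<otimes>\<^bsub>Sym\<^esub> a" if "a \<in> A" "t \<in> {rot}" for a t
    using that diag_rot_commute KD by (auto simp: A_def)
  have rot_sub: "{rot} \<subseteq> carrier Sym" using rot_mem by simp
  have comm: "a \<otimes>\<^bsub>Sym\<^esub> b = b \<otimes>\<^bsub>Sym\<^esub> a" if "a \<in> A" "b \<in> F" for a b
    using Sym.generate_commute[OF A.subset rot_sub comm_rot] that generate.incl[of a A Sym]
    unfolding F_def by blast
  then show "\<forall>a\<in>A. \<forall>b\<in>F. a \<otimes>\<^bsub>Sym\<^esub> b = b \<otimes>\<^bsub>Sym\<^esub> a" by blast
  have F_pow: "rot [^]\<^bsub>Sym\<^esub> i \<in> F" for i :: nat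
    unfolding F_def by (rule rot_pow_mem_generate)
  have cosets_eq: "(rot [^]\<^bsub>Sym\<^esub> i) <#\<^bsub>Sym\<^esub> A = A #>\<^bsub>Sym\<^esub> (rot [^]\<^bsub>Sym\<^esub> i)" for i :: nat
    using comm[OF _ F_pow] by (simp add: l_coset_def r_coset_def)
  have Kbar_mult: "Kbar = A <#>\<^bsub>Sym\<^esub> F"
    unfolding Kbar_def F_def A_def[symmetric]
    using A rot_sub comm_rot by (rule Sym.generate_commuting_union)
  then show r_cosets: "Kbar = (\<Union>i<n. A #>\<^bsub>Sym\<^esub> (rot [^]\<^bsub>Sym\<^esub> i))"
    unfolding F_def generate_rot by (auto simp: set_mult_def r_coset_def)
  then show l_cosets: "Kbar = (\<Union>i<n. (rot [^]\<^bsub>Sym\<^esub> i) <#\<^bsub>Sym\<^esub> A)"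
    by (simp add: cosets_eq)
  have shift: "t ` S j = S (cyc n (j + i))"
    if t: "t \<in> (rot [^]\<^bsub>Sym\<^esub> i) <#\<^bsub>Sym\<^esub> A" and j: "j \<in> {1..n}" for t i j
  proof -
    obtain h where "h \<in> K" "t = rot [^]\<^bsub>Sym\<^esub> i \<otimes>\<^bsub>Sym\<^esub> diag h"
      using t unfolding l_coset_def A_def by blast
    then show ?thesis using rot_pow_diag_image[OF KD j] by simp
  qed
  have one: "1 \<in> {1..n}" using n by simp
  have index: "i mod n = k mod n"
    if "t \<in> (rot [^]\<^bsub>Sym\<^esub> i) <#\<^bsub>Sym\<^esub> A" "t ` S 1 = S (cyc n (1 + k))" for t i k
  proof -
    have "S (cyc n (1 + i)) = S (cyc n (1 + k))"
      using shift[OF that(1) one] that(2) by simp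
    then have "cyc n (1 + i) = cyc n (1 + k)"
      unfolding S_eq_iff[OF cyc_mem[OF n] cyc_mem[OF n]] .
    then show ?thesis by (simp only: cyc_add_eq_iff)
  qed
  show l_disj: "disjoint_family_on (\<lambda>i. (rot [^]\<^bsub>Sym\<^esub> i) <#\<^bsub>Sym\<^esub> A) {..<n}"
    unfolding disjoint_family_on_def
  proof (intro ballI impI, rule ccontr)
    fix i k assume ik: "i \<in> {..<n}" "k \<in> {..<n}" "i \<noteq> k"
      and "((rot [^]\<^bsub>Sym\<^esub> i) <#\<^bsub>Sym\<^esub> A) \<inter> ((rot [^]\<^bsub>Sym\<^esub> k) <#\<^bsub>Sym\<^esub> A) \<noteq> {}"
    then obtain t where "t \<in> (rot [^]\<^bsub>Sym\<^esub> i) <#\<^bsub>Sym\<^esub> A" "t \<in> (rot [^]\<^bsub>Sym\<^esub> k) <#\<^bsub>Sym\<^esub> A"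
      by blast
    then have "i mod n = k mod n" using index shift[OF _ one] by blast
    then show False using ik by simp
  qed
  then show "disjoint_family_on (\<lambda>i. A #>\<^bsub>Sym\<^esub> (rot [^]\<^bsub>Sym\<^esub> i)) {..<n}"
    by (simp add: cosets_eq)
  have coset: "(rot [^]\<^bsub>Sym\<^esub> i) <#\<^bsub>Sym\<^esub> A = {t \<in> Kbar. \<forall>j\<in>{1..n}. t ` S j = S (cyc n (j + i))}"
    for i :: nat
  proof (intro equalityI subsetI)
    fix t assume t: "t \<in> (rot [^]\<^bsub>Sym\<^esub> i) <#\<^bsub>Sym\<^esub> A"
    then have "t \<in> (rot [^]\<^bsub>Sym\<^esub> (i mod n)) <#\<^bsub>Sym\<^esub> A"
      using rot_pow_eq_iff[of "i mod n" i] by simp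
    then have "t \<in> Kbar"
      using n unfolding l_cosets by (intro UN_I[of "i mod n"]) auto
    then show "t \<in> {t \<in> Kbar. \<forall>j\<in>{1..n}. t ` S j = S (cyc n (j + i))}"
      using shift[OF t] by blast
  next
    fix t assume t: "t \<in> {t \<in> Kbar. \<forall>j\<in>{1..n}. t ` S j = S (cyc n (j + i))}"
    then obtain k :: nat where k: "t \<in> (rot [^]\<^bsub>Sym\<^esub> k) <#\<^bsub>Sym\<^esub> A" unfolding l_cosets by blast
    then have "k mod n = i mod n" using index t one by blast
    then show "t \<in> (rot [^]\<^bsub>Sym\<^esub> i) <#\<^bsub>Sym\<^esub> A" using k rot_pow_eq_iff by metis
  qed
  then show "\<forall>i::nat. (rot [^]\<^bsub>Sym\<^esub> i) <#\<^bsub>Sym\<^esub> A = A #>\<^bsub>Sym\<^esub> (rot [^]\<^bsub>Sym\<^esub> i) \<and>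
      (rot [^]\<^bsub>Sym\<^esub> i) <#\<^bsub>Sym\<^esub> A = {t \<in> Kbar. \<forall>j\<in>{1..n}. t ` S j = S (cyc n (j + i))}"
    using cosets_eq by blast
  have zero: "(rot [^]\<^bsub>Sym\<^esub> (0::nat)) <#\<^bsub>Sym\<^esub> A = A"
    using A.subset by (auto simp: l_coset_def)
  show "A = {t \<in> Kbar. \<forall>j\<in>{1..n}. t ` S j = S j}"
    using coset[of 0] cyc_id unfolding zero by simp
  have "A \<inter> F \<subseteq> {\<one>\<^bsub>Sym\<^esub>}"
  proof
    fix t assume t: "t \<in> A \<inter> F"
    then obtain i :: nat where i: "t = rot [^]\<^bsub>Sym\<^esub> i" unfolding F_def generate_rot by blast
    then have "t \<otimes>\<^bsub>Sym\<^esub> \<one>\<^bsub>Sym\<^esub> \<in> (rot [^]\<^bsub>Sym\<^esub> i) <#\<^bsub>Sym\<^esub> A"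
      unfolding l_coset_def using A.one_closed by blast
    then have "t \<in> (rot [^]\<^bsub>Sym\<^esub> i) <#\<^bsub>Sym\<^esub> A" using t by simp
    moreover have "t \<in> (rot [^]\<^bsub>Sym\<^esub> (0::nat)) <#\<^bsub>Sym\<^esub> A" using t zero by blast
    ultimately have "i mod n = 0 mod n" using index shift[OF _ one] by blast
    then show "t \<in> {\<one>\<^bsub>Sym\<^esub>}" using i rot_pow_eq_iff[of i 0] by simp
  qed
  then show "internal_direct_product (Sym\<lparr>carrier := Kbar\<rparr>) A F"
    unfolding Kbar_def F_def A_def[symmetric]
    using Sym.internal_direct_product_generate[OF A rot_sub comm_rot] by blast
qed

lemma diag_rot_subgroup:
  assumes "subgroup K (BijGroup (S 1))"
  shows "subgroup (generate Sym (diag ` K \<union> {rot})) Sym"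
  using subgroup.subset[OF assms] diag_mem rot_mem by (intro Sym.generate_is_subgroup) auto

lemma diag_rot_split_exact:
  assumes K: "subgroup K (BijGroup (S 1))"
  defines "A \<equiv> diag ` K" and "F \<equiv> generate Sym {rot}" and "Kbar \<equiv> generate Sym (diag ` K \<union> {rot})"
  shows "\<exists>\<pi>. (\<forall>a\<in>A. \<forall>i::nat. \<pi> (a \<otimes>\<^bsub>Sym\<^esub> rot [^]\<^bsub>Sym\<^esub> i) = rot [^]\<^bsub>Sym\<^esub> i) \<and>
    short_exact_sequence (Sym\<lparr>carrier := F\<rparr>) (Sym\<lparr>carrier := Kbar\<rparr>) (Sym\<lparr>carrier := A\<rparr>)
      \<pi> (\<lambda>x. x) \<and>
    left_split (Sym\<lparr>carrier := A\<rparr>) (Sym\<lparr>carrier := Kbar\<rparr>) (\<lambda>x. x) \<and>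
    isomorphic_to_direct_product_sequence
      (Sym\<lparr>carrier := A\<rparr>) (Sym\<lparr>carrier := Kbar\<rparr>) (Sym\<lparr>carrier := F\<rparr>) (\<lambda>x. x) \<pi>"
proof -
  have "group (Sym\<lparr>carrier := Kbar\<rparr>)"
    unfolding Kbar_def using diag_rot_subgroup[OF K] by (rule Sym.subgroup_imp_group)
  moreover have "internal_direct_product (Sym\<lparr>carrier := Kbar\<rparr>) A F"
    unfolding assms(2-4) using K by (rule diag_rot_structure)
  ultimately obtain \<pi> where
    "(\<forall>a\<in>A. \<forall>b\<in>F. \<pi> (a \<otimes>\<^bsub>Sym\<lparr>carrier := Kbar\<rparr>\<^esub> b) = b) \<and>
     short_exact_sequence (Sym\<lparr>carrier := Kbar, carrier := F\<rparr>) (Sym\<lparr>carrier := Kbar\<rparr>)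
       (Sym\<lparr>carrier := Kbar, carrier := A\<rparr>) \<pi> (\<lambda>x. x) \<and>
     left_split (Sym\<lparr>carrier := Kbar, carrier := A\<rparr>) (Sym\<lparr>carrier := Kbar\<rparr>) (\<lambda>x. x) \<and>
     isomorphic_to_direct_product_sequence (Sym\<lparr>carrier := Kbar, carrier := A\<rparr>)
       (Sym\<lparr>carrier := Kbar\<rparr>) (Sym\<lparr>carrier := Kbar, carrier := F\<rparr>) (\<lambda>x. x) \<pi>"
    using internal_direct_product_split_exact by blast
  moreover have "rot [^]\<^bsub>Sym\<^esub> (i::nat) \<in> F" for i
    unfolding F_def by (rule rot_pow_mem_generate)
  ultimately show ?thesis
    by (intro exI[of _ \<pi>]) simp
qed

text \<open>The diagonal copy of \<open>K\<close> adjusts the coordinate in \<open>S 1\<close>, a power of the rotation then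
  adjusts the index of the copy.\<close>

lemma diag_rot_transitive:
  assumes K: "subgroup K (BijGroup (S 1))"
    and trans: "\<And>s t. s \<in> S 1 \<Longrightarrow> t \<in> S 1 \<Longrightarrow> \<exists>a\<in>K. a s = t"
    and xy: "x \<in> total_set n S" "y \<in> total_set n S"
  shows "\<exists>a\<in>generate Sym (diag ` K \<union> {rot}). a x = y"
proof -
  obtain j s where j: "j \<in> {1..n}" "s \<in> S 1" "x = f j s" using xy(1) by (rule total_set_cases)
  obtain k t where k: "k \<in> {1..n}" "t \<in> S 1" "y = f k t" using xy(2) by (rule total_set_cases)
  obtain a where a: "a \<in> K" "a s = t" using trans j k by blast
  \<comment> \<open>\<open>k - j\<close> modulo \<open>n\<close>, with \<open>n\<close> added so that the subtraction of naturals is exact\<close>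
  define i where "i = k + n - j"
  have aD: "a \<in> carrier (BijGroup (S 1))" using subgroup.subset[OF K] a by blast
  have "cyc n (j + i) = cyc n (k + n)" using j by (simp add: i_def)
  also have "\<dots> = k"
    using cyc_add_eq_iff[of k n n 0] cyc_id[OF k(1)] k(1) by simp
  finally have "(rot [^]\<^bsub>Sym\<^esub> i \<otimes>\<^bsub>Sym\<^esub> diag a) x = y"
    using j k a aD by (simp add: BijGroup_mult_apply diag_mem rot_mem f_mem_total diag_apply rot_pow_apply)
  moreover have "rot [^]\<^bsub>Sym\<^esub> i \<otimes>\<^bsub>Sym\<^esub> diag a \<in> generate Sym (diag ` K \<union> {rot})"
  proof (rule generate.eng)
    show "rot [^]\<^bsub>Sym\<^esub> i \<in> generate Sym (diag ` K \<union> {rot})"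
      using rot_pow_mem_generate Sym.mono_generate[of "{rot}" "diag ` K \<union> {rot}"] by blast
    show "diag a \<in> generate Sym (diag ` K \<union> {rot})"
      using a by (intro generate.incl) simp
  qed
  ultimately show ?thesis by blast
qed

text \<open>The generators of the two groups commute in pairs: diagonal copies because \<open>K\<close> and \<open>L\<close> commute, the
  rotation because it commutes with every diagonal map. Both groups are transitive, so rigidity
  of commuting transitive groups does the rest.\<close>

lemma diag_rot_lewin_dual:
  assumes dual: "lewin_dual (S 1) K L"
  shows "lewin_dual (total_set n S)
    (generate Sym (diag ` K \<union> {rot})) (generate Sym (diag ` L \<union> {rot}))"
proof -
  interpret diag: group_hom "BijGroup (S 1)" Sym diag by (rule diag_hom)
  have K: "subgroup K (BijGroup (S 1))" and L: "subgroup L (BijGroup (S 1))"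
    and stK: "simply_transitive_action (BijGroup (S 1)\<lparr>carrier := K\<rparr>) (S 1) (\<lambda>t. t)"
    and stL: "simply_transitive_action (BijGroup (S 1)\<lparr>carrier := L\<rparr>) (S 1) (\<lambda>t. t)"
    and LK: "L = centralizer (BijGroup (S 1)) K"
    using dual unfolding lewin_dual_def by blast+
  have transK: "\<exists>a\<in>K. a s = t" if "s \<in> S 1" "t \<in> S 1" for s t
    using simply_transitive_action.unique_transporter[OF stK that] by auto
  have transL: "\<exists>a\<in>L. a s = t" if "s \<in> S 1" "t \<in> S 1" for s t
    using simply_transitive_action.unique_transporter[OF stL that] by auto
  have sub: "K \<subseteq> carrier (BijGroup (S 1))" "L \<subseteq> carrier (BijGroup (S 1))"
    using K L by (auto dest: subgroup.subset)
  have "diag a \<otimes>\<^bsub>Sym\<^esub> diag b = diag b \<otimes>\<^bsub>Sym\<^esub> diag a" if "a \<in> K" "b \<in> L" for a b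
  proof -
    have "a \<otimes>\<^bsub>BijGroup (S 1)\<^esub> b = b \<otimes>\<^bsub>BijGroup (S 1)\<^esub> a"
      using that by (auto simp: LK centralizer_def)
    moreover have "a \<in> carrier (BijGroup (S 1))" "b \<in> carrier (BijGroup (S 1))"
      using that sub by blast+
    ultimately show ?thesis
      by (simp flip: diag.hom_mult)
  qed
  then have gen_comm: "a \<otimes>\<^bsub>Sym\<^esub> b = b \<otimes>\<^bsub>Sym\<^esub> a"
    if "a \<in> diag ` K \<union> {rot}" "b \<in> diag ` L \<union> {rot}" for a b
    using that sub diag_rot_commute by auto
  have gens: "diag ` K \<union> {rot} \<subseteq> carrier Sym" "diag ` L \<union> {rot} \<subseteq> carrier Sym"
    using sub diag_mem rot_mem by auto
  show ?thesis
  proof (rule commuting_transitive_subgroups_lewin_dual)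
    show "total_set n S \<noteq> {}" using n nonempty by (force simp: total_set_def)
  qed (rule diag_rot_subgroup[OF K] diag_rot_subgroup[OF L] diag_rot_transitive[OF K transK]
      diag_rot_transitive[OF L transL] Sym.generate_commute[OF gens gen_comm]; assumption)+
qed

lemma conj_action_faithful:
  assumes K: "subgroup K (BijGroup (S 1))" and j: "j \<in> {1..n}"
  shows "faithful_action (BijGroup (S 1)\<lparr>carrier := K\<rparr>) (S j) (conj_action S f j)"
proof -
  have sub: "K \<subseteq> carrier (BijGroup (S 1))" using subgroup.subset[OF K] .
  have app: "conj_action S f j h (f j s) = f j (h s)" if "s \<in> S 1" for h s
    using f_mem[OF j that] inv_into_f[OF j that] by (simp add: conj_action_def)
  have mem: "conj_action S f j h \<in> carrier (BijGroup (S j))" if "h \<in> K" for h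
  proof -
    have h: "bij_betw h (S 1) (S 1)" using sub that by (auto simp: BijGroup_def Bij_def)
    have "bij_betw (f j \<circ> h \<circ> inv_into (S 1) (f j)) (S j) (S j)"
      using bij_betw_trans[OF bij_betw_inv_into[OF f_bij[OF j]] bij_betw_trans[OF h f_bij[OF j]]]
      by (simp add: comp_assoc)
    then have "bij_betw (conj_action S f j h) (S j) (S j)"
      by (rule bij_betw_cong[THEN iffD1, rotated]) (simp add: conj_action_def)
    then show ?thesis by (simp add: BijGroup_def Bij_def conj_action_def)
  qed
  show ?thesis
  proof (intro faithful_action.intro group_action.intro group_hom.intro group_hom_axioms.intro
      faithful_action_axioms.intro homI group_BijGroup)
    show "group (BijGroup (S 1)\<lparr>carrier := K\<rparr>)"
      using K by (rule group.subgroup_imp_group[OF group_BijGroup])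
    show "conj_action S f j h \<in> carrier (BijGroup (S j))"
      if "h \<in> carrier (BijGroup (S 1)\<lparr>carrier := K\<rparr>)" for h using mem that by simp
  next
    fix g h assume "g \<in> carrier (BijGroup (S 1)\<lparr>carrier := K\<rparr>)" "h \<in> carrier (BijGroup (S 1)\<lparr>carrier := K\<rparr>)"
    then have gh: "g \<in> K" "h \<in> K" by auto
    then have ghm: "g \<otimes>\<^bsub>BijGroup (S 1)\<^esub> h \<in> K" using subgroup.m_closed[OF K] by blast
    have "conj_action S f j (g \<otimes>\<^bsub>BijGroup (S 1)\<^esub> h) =
        conj_action S f j g \<otimes>\<^bsub>BijGroup (S j)\<^esub> conj_action S f j h"
    proof (rule BijGroup_eqI[OF mem[OF ghm]])
      show "conj_action S f j g \<otimes>\<^bsub>BijGroup (S j)\<^esub> conj_action S f j h \<in> carrier (BijGroup (S j))"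
        by (intro monoid.m_closed[OF group.is_monoid[OF group_BijGroup]] mem gh)
      fix x assume x: "x \<in> S j"
      then obtain s where s: "s \<in> S 1" "x = f j s" by (rule S_cases[OF j])
      have hs: "h s \<in> S 1"
        using BijGroup_apply_mem[OF subsetD[OF sub gh(2)] s(1)] .
      have "(conj_action S f j g \<otimes>\<^bsub>BijGroup (S j)\<^esub> conj_action S f j h) x = f j (g (h s))"
        using BijGroup_mult_apply[OF mem mem x, OF gh] app[OF s(1)] app[OF hs] s(2) by simp
      moreover have "(g \<otimes>\<^bsub>BijGroup (S 1)\<^esub> h) s = g (h s)"
        by (rule BijGroup_mult_apply[OF subsetD[OF sub gh(1)] subsetD[OF sub gh(2)] s(1)])
      ultimately show "conj_action S f j (g \<otimes>\<^bsub>BijGroup (S 1)\<^esub> h) x =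
          (conj_action S f j g \<otimes>\<^bsub>BijGroup (S j)\<^esub> conj_action S f j h) x"
        using s app by simp
    qed
    then show "conj_action S f j (g \<otimes>\<^bsub>BijGroup (S 1)\<lparr>carrier := K\<rparr>\<^esub> h) =
        conj_action S f j g \<otimes>\<^bsub>BijGroup (S j)\<^esub> conj_action S f j h" by simp
  next
    show "inj_on (conj_action S f j) (carrier (BijGroup (S 1)\<lparr>carrier := K\<rparr>))"
    proof (rule inj_onI)
      fix g h assume "g \<in> carrier (BijGroup (S 1)\<lparr>carrier := K\<rparr>)"
        "h \<in> carrier (BijGroup (S 1)\<lparr>carrier := K\<rparr>)" and eq: "conj_action S f j g = conj_action S f j h"
      then have gh: "g \<in> carrier (BijGroup (S 1))" "h \<in> carrier (BijGroup (S 1))" using sub by auto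
      then show "g = h"
      proof (rule BijGroup_eqI)
        fix s assume s: "s \<in> S 1"
        then have "f j (g s) = f j (h s)" using app eq by metis
        then show "g s = h s"
          using f_eq_iff[OF j j] gh s BijGroup_apply_mem by metis
      qed
    qed
  qed
qed

lemma conj_action_equivariant:
  assumes K: "K \<subseteq> carrier (BijGroup (S 1))" and j: "j \<in> {1..n}"
  shows "equivariant (BijGroup (S 1)\<lparr>carrier := K\<rparr>) (S 1) (\<lambda>h. h) (S j) (conj_action S f j) (f j)"
  using f_mem[OF j] inv_into_f[OF j] by (simp add: equivariant_def conj_action_def)

text \<open>Stated for an action that factors through the diagonal embedding, so as to cover \<open>G\<close>, through
  its action on \<open>S 1\<close>, as well as a subgroup of the symmetric group of \<open>S 1\<close>.\<close>

lemma diag_action_faithful_rot_equivariant: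
  assumes G: "group_hom G (BijGroup (S 1)) \<chi>" and inj: "inj_on \<chi> (carrier G)"
    and \<Phi>: "\<And>g. g \<in> carrier G \<Longrightarrow> \<Phi> g = diag (\<chi> g)"
  shows "faithful_action G (total_set n S) \<Phi>"
    and "equivariant G (total_set n S) \<Phi> (total_set n S) \<Phi> rot"
proof -
  interpret \<chi>: group_hom G "BijGroup (S 1)" \<chi> by fact
  interpret diag: group_hom "BijGroup (S 1)" Sym diag by (rule diag_hom)
  have "\<Phi> \<in> hom G Sym"
    by (rule homI) (simp_all add: \<Phi> del: One_nat_def)
  moreover have "inj_on \<Phi> (carrier G)"
  proof (rule inj_onI)
    fix g h assume gh: "g \<in> carrier G" "h \<in> carrier G" "\<Phi> g = \<Phi> h"
    then have "\<chi> g = \<chi> h" using inj_onD[OF diag_inj, of "\<chi> g" "\<chi> h"] \<Phi> by (simp del: One_nat_def)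
    then show "g = h" using inj gh by (simp add: inj_on_eq_iff)
  qed
  ultimately show "faithful_action G (total_set n S) \<Phi>"
    by (intro faithful_action.intro group_action.intro group_hom.intro group_hom_axioms.intro
        faithful_action_axioms.intro \<chi>.G.is_group Sym.is_group)
  have "rot (\<Phi> g x) = \<Phi> g (rot x)" if "g \<in> carrier G" "x \<in> total_set n S" for g x
    using diag_rot_commute[of "\<chi> g"] that rot_mem diag_mem[of "\<chi> g"] \<Phi>
      BijGroup_mult_apply[of rot "total_set n S" "diag (\<chi> g)" x]
      BijGroup_mult_apply[of "diag (\<chi> g)" "total_set n S" rot x]
    by (simp del: One_nat_def)
  then show "equivariant G (total_set n S) \<Phi> (total_set n S) \<Phi> rot"
    using BijGroup_apply_mem[OF rot_mem] by (auto simp: equivariant_def)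
qed

text \<open>At \<open>f\<^sub>j s\<close> both sides are \<open>f\<^sub>j (g s)\<close>, the left one by equivariance of \<open>f\<^sub>j\<close>.\<close>

lemma union_action_eq_diag:
  assumes eqv: "\<And>j. j \<in> {1..n} \<Longrightarrow> equivariant G (S 1) (\<phi> 1) (S j) (\<phi> j) (f j)"
    and g: "g \<in> carrier G"
  shows "union_action n S \<phi> g = diag (\<phi> 1 g)"
proof
  fix x
  show "union_action n S \<phi> g x = diag (\<phi> 1 g) x"
  proof (cases "x \<in> total_set n S")
    case True
    then obtain j s where js: "j \<in> {1..n}" "s \<in> S 1" "x = f j s" by (rule total_set_cases)
    have "union_action n S \<phi> g x = \<phi> j g x"
      unfolding union_action_def using glue_apply[OF disjoint js(1)] f_mem js by blast
    then show ?thesis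
      using eqv[OF js(1)] g js diag_apply by (simp add: equivariant_def)
  qed (simp add: union_action_def glue_def)
qed

end

section \<open>Groups extended by the meta-rotation\<close>

theorem theorem6p1:
  fixes G :: "('g, 'm) monoid_scheme"
    and n :: nat
    and S :: "nat \<Rightarrow> 'a set"
    and \<phi> :: "nat \<Rightarrow> 'g \<Rightarrow> 'a \<Rightarrow> 'a"
    and f :: "nat \<Rightarrow> 'a \<Rightarrow> 'a"
  assumes n: "1 \<le> n"
    and nonempty: "S 1 \<noteq> {}"
    and disjoint: "disjoint_family_on S {1..n}"
    and faithful: "\<forall>j\<in>{1..n}. faithful_action G (S j) (\<phi> j)"
    and f_bij: "\<forall>j\<in>{2..n}. bij_betw (f j) (S 1) (S j)"
    and f_equivariant: "\<forall>j\<in>{2..n}. equivariant G (S 1) (\<phi> 1) (S j) (\<phi> j) (f j)"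
    and f_1: "\<forall>x\<in>S 1. f 1 x = x"
  shows
    "let Sbar = total_set n S;
         Sym = BijGroup Sbar;
         fbar = meta_rotation n S f;
         F = generate Sym {fbar};
         \<Phi> = union_action n S \<phi>;
         GS = \<Phi> ` carrier G;
         Gbar = generate Sym (GS \<union> {fbar});
         H = centralizer (BijGroup (S 1)) (\<phi> 1 ` carrier G);
         HG = BijGroup (S 1)\<lparr>carrier := H\<rparr>;
         \<psi> = conj_action S f;
         \<Psi> = union_action n S \<psi>;
         HS = \<Psi> ` H;
         Hbar = generate Sym (HS \<union> {fbar})
     in
      \<comment> \<open>the action on the union\<close>
      faithful_action G Sbar \<Phi> \<and>
      \<comment> \<open>(1)\<close>
      (fbar \<in> carrier Sym \<and>
       equivariant G Sbar \<Phi> Sbar \<Phi> fbar \<and>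
       group.ord Sym fbar = n) \<and>
      \<comment> \<open>(2)\<close>
      ((\<forall>a\<in>GS. \<forall>b\<in>F. a \<otimes>\<^bsub>Sym\<^esub> b = b \<otimes>\<^bsub>Sym\<^esub> a) \<and>
       internal_direct_product (Sym\<lparr>carrier := Gbar\<rparr>) GS F \<and>
       Gbar = (\<Union>i<n. (fbar [^]\<^bsub>Sym\<^esub> i) <#\<^bsub>Sym\<^esub> GS) \<and>
       disjoint_family_on (\<lambda>i. (fbar [^]\<^bsub>Sym\<^esub> i) <#\<^bsub>Sym\<^esub> GS) {..<n} \<and>
       Gbar = (\<Union>i<n. GS #>\<^bsub>Sym\<^esub> (fbar [^]\<^bsub>Sym\<^esub> i)) \<and>
       disjoint_family_on (\<lambda>i. GS #>\<^bsub>Sym\<^esub> (fbar [^]\<^bsub>Sym\<^esub> i)) {..<n} \<and>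
       GS = {t \<in> Gbar. \<forall>j\<in>{1..n}. t ` S j = S j} \<and>
       (\<forall>i::nat. (fbar [^]\<^bsub>Sym\<^esub> i) <#\<^bsub>Sym\<^esub> GS = GS #>\<^bsub>Sym\<^esub> (fbar [^]\<^bsub>Sym\<^esub> i) \<and>
          (fbar [^]\<^bsub>Sym\<^esub> i) <#\<^bsub>Sym\<^esub> GS
            = {t \<in> Gbar. \<forall>j\<in>{1..n}. t ` S j = S (cyc n (j + i))})) \<and>
      \<comment> \<open>(3)\<close>
      (\<exists>\<pi>. (\<forall>g\<in>GS. \<forall>i::nat. \<pi> (g \<otimes>\<^bsub>Sym\<^esub> fbar [^]\<^bsub>Sym\<^esub> i) = fbar [^]\<^bsub>Sym\<^esub> i) \<and>
         short_exact_sequence (Sym\<lparr>carrier := F\<rparr>) (Sym\<lparr>carrier := Gbar\<rparr>) (Sym\<lparr>carrier := GS\<rparr>)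
           \<pi> (\<lambda>x. x) \<and>
         left_split (Sym\<lparr>carrier := GS\<rparr>) (Sym\<lparr>carrier := Gbar\<rparr>) (\<lambda>x. x) \<and>
         isomorphic_to_direct_product_sequence
           (Sym\<lparr>carrier := GS\<rparr>) (Sym\<lparr>carrier := Gbar\<rparr>) (Sym\<lparr>carrier := F\<rparr>) (\<lambda>x. x) \<pi>) \<and>
      \<comment> \<open>(4)\<close>
      ((\<exists>j0\<in>{1..n}. simply_transitive_action G (S j0) (\<phi> j0)) \<longrightarrow>
        (\<forall>j\<in>{1..n}. simply_transitive_action G (S j) (\<phi> j)) \<and>
        simply_transitive_action (Sym\<lparr>carrier := Gbar\<rparr>) Sbar (\<lambda>t. t)) \<and>
      \<comment> \<open>(5)\<close>
      (simply_transitive_action G (S 1) (\<phi> 1) \<longrightarrow>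
        lewin_dual (S 1) (\<phi> 1 ` carrier G) H \<and>
        (\<forall>j\<in>{1..n}. faithful_action HG (S j) (\<psi> j) \<and>
           equivariant HG (S 1) (\<lambda>h. h) (S j) (\<psi> j) (f j)) \<and>
        faithful_action HG Sbar \<Psi> \<and>
        Hbar = centralizer Sym Gbar \<and>
        lewin_dual Sbar Gbar Hbar \<and>
        \<comment> \<open>(i)\<close>
        equivariant HG Sbar \<Psi> Sbar \<Psi> fbar \<and>
        \<comment> \<open>(ii)\<close>
        ((\<forall>a\<in>HS. \<forall>b\<in>F. a \<otimes>\<^bsub>Sym\<^esub> b = b \<otimes>\<^bsub>Sym\<^esub> a) \<and>
         internal_direct_product (Sym\<lparr>carrier := Hbar\<rparr>) HS F \<and>
         Hbar = (\<Union>i<n. (fbar [^]\<^bsub>Sym\<^esub> i) <#\<^bsub>Sym\<^esub> HS) \<and>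
         disjoint_family_on (\<lambda>i. (fbar [^]\<^bsub>Sym\<^esub> i) <#\<^bsub>Sym\<^esub> HS) {..<n} \<and>
         Hbar = (\<Union>i<n. HS #>\<^bsub>Sym\<^esub> (fbar [^]\<^bsub>Sym\<^esub> i)) \<and>
         disjoint_family_on (\<lambda>i. HS #>\<^bsub>Sym\<^esub> (fbar [^]\<^bsub>Sym\<^esub> i)) {..<n} \<and>
         HS = {t \<in> Hbar. \<forall>j\<in>{1..n}. t ` S j = S j} \<and>
         (\<forall>i::nat. (fbar [^]\<^bsub>Sym\<^esub> i) <#\<^bsub>Sym\<^esub> HS = HS #>\<^bsub>Sym\<^esub> (fbar [^]\<^bsub>Sym\<^esub> i) \<and>
            (fbar [^]\<^bsub>Sym\<^esub> i) <#\<^bsub>Sym\<^esub> HS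
              = {t \<in> Hbar. \<forall>j\<in>{1..n}. t ` S j = S (cyc n (j + i))})) \<and>
        \<comment> \<open>(iii)\<close>
        (\<exists>\<pi>. (\<forall>h\<in>HS. \<forall>i::nat. \<pi> (h \<otimes>\<^bsub>Sym\<^esub> fbar [^]\<^bsub>Sym\<^esub> i) = fbar [^]\<^bsub>Sym\<^esub> i) \<and>
           short_exact_sequence (Sym\<lparr>carrier := F\<rparr>) (Sym\<lparr>carrier := Hbar\<rparr>) (Sym\<lparr>carrier := HS\<rparr>)
             \<pi> (\<lambda>x. x) \<and>
           left_split (Sym\<lparr>carrier := HS\<rparr>) (Sym\<lparr>carrier := Hbar\<rparr>) (\<lambda>x. x) \<and>
           isomorphic_to_direct_product_sequence
             (Sym\<lparr>carrier := HS\<rparr>) (Sym\<lparr>carrier := Hbar\<rparr>) (Sym\<lparr>carrier := F\<rparr>) (\<lambda>x. x) \<pi>) \<and>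
        \<comment> \<open>(iv)\<close>
        (\<forall>j\<in>{1..n}. simply_transitive_action HG (S j) (\<psi> j)) \<and>
        simply_transitive_action (Sym\<lparr>carrier := Hbar\<rparr>) Sbar (\<lambda>t. t)) \<and>
      \<comment> \<open>(6)\<close>
      (simply_transitive_action G (S 1) (\<phi> 1) \<longrightarrow>
        (\<forall>h\<in>H. fbar \<otimes>\<^bsub>Sym\<^esub> \<Psi> h = \<Psi> h \<otimes>\<^bsub>Sym\<^esub> fbar \<and>
          (\<forall>j\<in>{1..n}. \<forall>x\<in>S j.
            (fbar \<otimes>\<^bsub>Sym\<^esub> \<Psi> h) x = f (cyc n (j + 1)) (h (inv_into (S 1) (f j) x)))))"
proof -
  have f1: "bij_betw (f 1) (S 1) (S 1)"
    using f_1 bij_betw_cong[of "S 1" "f 1" "\<lambda>x. x" "S 1"] by (simp add: bij_betw_def)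
  have bij: "bij_betw (f j) (S 1) (S j)" if "j \<in> {1..n}" for j
    using f1 f_bij that by (cases "j = 1") auto
  interpret disjoint_copies n S f
    by unfold_locales (use n nonempty disjoint bij in auto)
  have one: "1 \<in> {1..n}" using n by simp
  have act: "group_action G (S j) (\<phi> j)" if "j \<in> {1..n}" for j
    using faithful that by (simp add: faithful_action_def)
  interpret \<phi>1: group_hom G "BijGroup (S 1)" "\<phi> 1"
    using group_action.group_hom[OF act[OF one]] .
  have eqv: "equivariant G (S 1) (\<phi> 1) (S j) (\<phi> j) (f j)" if "j \<in> {1..n}" for j
  proof (cases "j = 1")
    case True
    then show ?thesis
      using f_1 group_action.element_image[OF act[OF one]] by (auto simp: equivariant_def)
  qed (use f_equivariant that in auto)
  have \<Phi>: "union_action n S \<phi> g = diag (\<phi> 1 g)" if "g \<in> carrier G" for g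
    using eqv that by (rule union_action_eq_diag)
  then have GS: "union_action n S \<phi> ` carrier G = diag ` (\<phi> 1 ` carrier G)"
    by (auto simp: image_image)
  let ?P = "\<phi> 1 ` carrier G"
  let ?H = "centralizer (BijGroup (S 1)) ?P"
  let ?HG = "BijGroup (S 1)\<lparr>carrier := ?H\<rparr>"
  have P: "subgroup ?P (BijGroup (S 1))" by (rule \<phi>1.img_is_subgroup)
  have H: "subgroup ?H (BijGroup (S 1))"
    by (rule \<phi>1.H.subgroup_centralizer[OF subgroup.subset[OF P]])
  have inj: "inj_on (\<phi> 1) (carrier G)"
    using faithful one by (auto simp: faithful_action_def faithful_action_axioms_def)
  have st_iff: "simply_transitive_action G (S 1) (\<phi> 1) \<longleftrightarrow> simply_transitive_action G (S j) (\<phi> j)"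
    if "j \<in> {1..n}" for j
    by (rule simply_transitive_action_transport[OF act[OF one] act[OF that] bij[OF that] eqv[OF that]])
  have dual1: "lewin_dual (S 1) ?P ?H" if "simply_transitive_action G (S 1) (\<phi> 1)"
    using nonempty that by (rule simply_transitive_action_lewin_dual)
  have dual: "lewin_dual (total_set n S) (generate Sym (diag ` ?P \<union> {rot}))
      (generate Sym (diag ` ?H \<union> {rot}))" if "simply_transitive_action G (S 1) (\<phi> 1)"
    using dual1[OF that] by (rule diag_rot_lewin_dual)
  have H_st: "simply_transitive_action ?HG (S j) (conj_action S f j)"
    if "simply_transitive_action G (S 1) (\<phi> 1)" "j \<in> {1..n}" for j
  proof -
    have "simply_transitive_action ?HG (S 1) (\<lambda>t. t)"
      using dual1[OF that(1)] by (simp add: lewin_dual_def)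
    moreover have "group_action ?HG (S j) (conj_action S f j)"
      using conj_action_faithful[OF H that(2)] by (simp add: faithful_action_def)
    ultimately show ?thesis
      using simply_transitive_action_transport[OF _ _ bij[OF that(2)]
          conj_action_equivariant[OF subgroup.subset[OF H] that(2)]]
      by (simp add: simply_transitive_action_def)
  qed
  have H_hom: "group_hom ?HG (BijGroup (S 1)) (\<lambda>h. h)"
    using group_BijGroup H by (rule group_hom_subgroup_incl)
  have formula: "rot \<otimes>\<^bsub>Sym\<^esub> diag h = diag h \<otimes>\<^bsub>Sym\<^esub> rot \<and>
      (\<forall>j\<in>{1..n}. \<forall>x\<in>S j.
        (rot \<otimes>\<^bsub>Sym\<^esub> diag h) x = f (cyc n (j + 1)) (h (inv_into (S 1) (f j) x)))" if "h \<in> ?H" for h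
  proof -
    have h: "h \<in> carrier (BijGroup (S 1))" using subgroup.subset[OF H] that by blast
    have "(rot \<otimes>\<^bsub>Sym\<^esub> diag h) x = f (cyc n (j + 1)) (h (inv_into (S 1) (f j) x))"
      if j: "j \<in> {1..n}" and x: "x \<in> S j" for j x
    proof -
      obtain s where s: "s \<in> S 1" "x = f j s" using j x by (rule S_cases)
      then show ?thesis
        using BijGroup_mult_apply[OF rot_mem diag_mem[OF h] f_mem_total[OF j s(1)]]
          BijGroup_apply_mem[OF h s(1)] j
        by (simp add: diag_apply rot_apply inv_into_f del: One_nat_def)
    qed
    then show ?thesis using diag_rot_commute[OF h] by simp
  qed
  show ?thesis
    unfolding Let_def GS
  proof (intro conjI impI)
    show "faithful_action G (total_set n S) (union_action n S \<phi>)"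
      "equivariant G (total_set n S) (union_action n S \<phi>) (total_set n S) (union_action n S \<phi>) rot"
      using diag_action_faithful_rot_equivariant[OF \<phi>1.group_hom_axioms inj \<Phi>] by blast+
    show "\<forall>j\<in>{1..n}. simply_transitive_action G (S j) (\<phi> j)"
      "simply_transitive_action (Sym\<lparr>carrier := generate Sym (diag ` ?P \<union> {rot})\<rparr>)
        (total_set n S) (\<lambda>t. t)"
      if "\<exists>j0\<in>{1..n}. simply_transitive_action G (S j0) (\<phi> j0)"
      using that st_iff dual unfolding lewin_dual_def by blast+
    show "\<forall>j\<in>{1..n}. faithful_action ?HG (S j) (conj_action S f j) \<and>
        equivariant ?HG (S 1) (\<lambda>h. h) (S j) (conj_action S f j) (f j)"
      using conj_action_faithful[OF H] conj_action_equivariant[OF subgroup.subset[OF H]] by blast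
    show "faithful_action ?HG (total_set n S) diag"
      "equivariant ?HG (total_set n S) diag (total_set n S) diag rot"
      using diag_action_faithful_rot_equivariant[OF H_hom] by simp_all
    show "generate Sym (diag ` ?H \<union> {rot}) = centralizer Sym (generate Sym (diag ` ?P \<union> {rot}))"
      "simply_transitive_action (Sym\<lparr>carrier := generate Sym (diag ` ?H \<union> {rot})\<rparr>)
        (total_set n S) (\<lambda>t. t)"
      if "simply_transitive_action G (S 1) (\<phi> 1)"
      using dual[OF that] unfolding lewin_dual_def by blast+
    show "\<forall>h\<in>?H. rot \<otimes>\<^bsub>Sym\<^esub> diag h = diag h \<otimes>\<^bsub>Sym\<^esub> rot \<and>
      (\<forall>j\<in>{1..n}. \<forall>x\<in>S j.
        (rot \<otimes>\<^bsub>Sym\<^esub> diag h) x = f (cyc n (j + 1)) (h (inv_into (S 1) (f j) x)))"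
      using formula by blast
    show "\<forall>j\<in>{1..n}. simply_transitive_action ?HG (S j) (conj_action S f j)"
      if "simply_transitive_action G (S 1) (\<phi> 1)"
      using H_st[OF that] by blast
  qed (rule rot_mem ord_rot diag_rot_structure[OF P] diag_rot_structure[OF H]
      diag_rot_split_exact[OF P] diag_rot_split_exact[OF H] dual1 dual; assumption?)+
qed

end
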